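(* Let $n$ be a positive integer, let $a_1,\ldots,a_n,b_1,\ldots,b_n>0$ be real numbers, and let $\mathcal{T}=(V,E)$ be a finite tree with vertex set $V$ and edge set $E$, where $E$ is identified with $\{1,2,\ldots,n\}$ (so that $|V|=n+1$). For every measurable set $A\subseteq\mathbb{R}^2$ satisfying $\overline{\delta}(A)>0$ there is a positive number $\lambda_0=\lambda_0(A,\mathcal{T},a_1,\ldots,a_n,b_1,\ldots,b_n)$ such that for each $\lambda\in[\lambda_0,\infty)$ one can find a set of points \[ \{x_v : v\in V\}\subseteq A \] satisfying \[ |x_u-x_v|=\lambda^{a_k}b_k\quad\text{for each edge } k\in E \text{ joining vertices } u,v\in V. \] In other words, for each $\lambda\in[\lambda_0,\infty)$ the set $A$ contains an embedding of the distance tree combinatorially isomorphic to $\mathcal{T}$ and having the numbers $\ell(k)=\lambda^{a_k}b_k$ as lengths of its edges $k\in E$.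
   Context: Measurability is with respect to Lebesgue measure; $|\cdot|$ of a measurable set denotes its Lebesgue measure, $|V|$ denotes the number of elements of the finite set $V$, and $|v|$ denotes the Euclidean norm of a vector $v$. For a measurable set $A\subseteq\mathbb{R}^d$ the upper Banach density is \[ \overline{\delta}(A):=\limsup_{R\to\infty}\,\sup_{x\in\mathbb{R}^d}\frac{|A\cap(x+[0,R]^d)|}{R^d}. \] Here $d=2$. A distance tree is a finite tree equipped with a function $\ell\colon E\to(0,\infty)$ on its edge set, where $\ell(k)$ is interpreted as the length of the edge $k$. In the embedding, each vertex $v\in V$ is represented by the point $x_v\in A$, and the length of an edge joining $u$ and $v$ is $|x_u-x_v|$. *)

theory Defs
  imports "HOL-Analysis.Analysis"
begin

text \<open>
  The limit superior and the supremum are taken in \<^typ>\<open>ereal\<close>, where they always exist;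
  \<^const>\<open>measure\<close> is harmless because the cube is bounded.
\<close>

definition upper_Banach_density :: "(real ^ 'd) set \<Rightarrow> ereal" where
  "upper_Banach_density A =
     Limsup at_top (\<lambda>R::real. SUP x::real ^ 'd.
       ereal (measure lebesgue (A \<inter> (\<lambda>y. x + y) ` cbox 0 (\<chi> i. R)) / R ^ CARD('d)))"

text \<open>
  Undirected simple graphs: edges are two-element sets of vertices.  The predicate \<open>tree\<close> of
  the AFP digraph library is not suitable here, since it only excludes directed cycles.
\<close>

definition finite_simple_graph :: "'v set \<Rightarrow> 'v set set \<Rightarrow> bool" where
  "finite_simple_graph V E \<longleftrightarrow> finite V \<and> (\<forall>e\<in>E. e \<subseteq> V \<and> card e = 2)"

definition graph_walk :: "'v set \<Rightarrow> 'v set set \<Rightarrow> 'v list \<Rightarrow> bool" where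
  "graph_walk V E p \<longleftrightarrow> p \<noteq> [] \<and> set p \<subseteq> V \<and> successively (\<lambda>u v. {u, v} \<in> E) p"

definition graph_connected :: "'v set \<Rightarrow> 'v set set \<Rightarrow> bool" where
  "graph_connected V E \<longleftrightarrow>
     V \<noteq> {} \<and> (\<forall>u\<in>V. \<forall>v\<in>V. \<exists>p. graph_walk V E p \<and> hd p = u \<and> last p = v)"

definition graph_cycle :: "'v set \<Rightarrow> 'v set set \<Rightarrow> 'v list \<Rightarrow> bool" where
  "graph_cycle V E p \<longleftrightarrow>
     graph_walk V E p \<and> distinct p \<and> length p \<ge> 3 \<and> {last p, hd p} \<in> E"

definition finite_tree :: "'v set \<Rightarrow> 'v set set \<Rightarrow> bool" where
  "finite_tree V E \<longleftrightarrow>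
     finite_simple_graph V E \<and> graph_connected V E \<and> (\<nexists>p. graph_cycle V E p)"

end

theory Submission
  imports Defs "HOL-Probability.Probability_Measure"
begin

text \<open>
  Let \<open>T\<^sub>r\<close> denote averaging over an arc of the circle of radius \<open>r\<close> around the point; its adjoint is
  \<open>T\<^sub>-\<^sub>r\<close>, and all these operators commute. The law of the difference of two independent points of the
  arc has an \<open>L\<^sup>1\<close> density by curvature, so \<open>T\<^sub>r T\<^sub>-\<^sub>r f\<close> hardly changes under translations much
  shorter than \<open>r\<close>. Hence the operators \<open>T\<^sub>r T\<^sub>-\<^sub>r - T\<^sub>r = T\<^sub>r (T\<^sub>-\<^sub>r - 1)\<close> are almost orthogonal for
  lacunary \<open>r\<close>, and by Bessel's inequality only boundedly many scales can be bad for the indicator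
  \<open>f\<close> of \<open>A\<close> in a large box, in the sense that \<open>T\<^sub>r f\<close> is far from \<open>T\<^sub>r T\<^sub>-\<^sub>r f\<close> in \<open>L\<^sup>2\<close>.

  At a good scale, let \<open>B\<close> be the set of points of \<open>A\<close> without a neighbour at distance \<open>r\<close> in a subset
  \<open>G\<close> of almost full measure in \<open>A\<close>. Since \<open>\<langle>1\<^sub>B, T\<^sub>r T\<^sub>-\<^sub>r 1\<^sub>B\<rangle> = \<parallel>T\<^sub>-\<^sub>r 1\<^sub>B\<parallel>\<^sup>2\<close> is at least of order
  \<open>|B|\<^sup>2\<close>, the set \<open>B\<close> is small. So leaves of the tree can be pruned one at a time, each time
  discarding a small part of the points admissible for the neighbour of the leaf. If the theorem
  failed for a lacunary sequence of parameters, one of them would be good for all edges at once.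
\<close>

section \<open>Continuity of translations in mean\<close>

lemma nn_integral_lborel_shift:
  fixes f :: "'a::euclidean_space \<Rightarrow> ennreal"
  assumes [measurable]: "f \<in> borel_measurable borel"
  shows "(\<integral>\<^sup>+x. f (x + v) \<partial>lborel) = (\<integral>\<^sup>+x. f x \<partial>lborel)"
  by (subst (2) lborel_distr_plus[of v, symmetric]) (simp add: nn_integral_distr add.commute)

lemma integral_lborel_shift:
  fixes f :: "'a::euclidean_space \<Rightarrow> real"
  assumes [measurable]: "f \<in> borel_measurable borel"
  shows "(\<integral>x. f (x + v) \<partial>lborel) = (\<integral>x. f x \<partial>lborel)"
  by (subst (2) lborel_distr_plus[of v, symmetric]) (simp add: integral_distr add.commute)

lemma integrable_lborel_shift:
  fixes f :: "'a::euclidean_space \<Rightarrow> real"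
  assumes "integrable lborel f"
  shows "integrable lborel (\<lambda>x. f (x + v))"
proof -
  have [measurable]: "f \<in> borel_measurable borel"
    using borel_measurable_integrable[OF assms] by simp
  have "integrable (distr lborel borel ((+) v)) f"
    using assms by (simp add: lborel_distr_plus)
  then show ?thesis
    by (simp add: integrable_distr_eq add.commute)
qed

text \<open>The absolute difference is the signed difference plus twice the indicator of the points
  that leave \<open>U\<close>. Translation invariance kills the integral of the first; the second
  tends to zero pointwise because \<open>U\<close> is open, and is dominated by the indicator of
  \<open>U\<close>.\<close>

lemma L1_translation_continuous_open:
  fixes U :: "'a::euclidean_space set"
  assumes "open U" and fin: "emeasure lborel U < \<infinity>"
  shows "((\<lambda>v. \<integral>x. \<bar>indicat_real U (x + v) - indicat_real U x\<bar> \<partial>lborel) \<longlongrightarrow> 0) (at 0)"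
proof -
  have [measurable]: "U \<in> sets borel" using assms by auto
  have int: "integrable lborel (indicat_real U)"
    using fin by simp
  have int': "integrable lborel (\<lambda>x. indicat_real U (x + v))" for v
    using integrable_lborel_shift[OF int] .
  have int2: "integrable lborel (\<lambda>x. indicat_real U x * (1 - indicat_real U (x + v)))" for v
    by (rule Bochner_Integration.integrable_bound[OF int]) (auto split: split_indicator)
  have eq: "(\<integral>x. \<bar>indicat_real U (x + v) - indicat_real U x\<bar> \<partial>lborel) =
      2 * (\<integral>x. indicat_real U x * (1 - indicat_real U (x + v)) \<partial>lborel)" for v
  proof -
    have "(\<integral>x. \<bar>indicat_real U (x + v) - indicat_real U x\<bar> \<partial>lborel) =
      (\<integral>x. (indicat_real U (x + v) - indicat_real U x) + 2 * (indicat_real U x * (1 - indicat_real U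
          (x + v))) \<partial>lborel)"
      by (rule Bochner_Integration.integral_cong) (auto split: split_indicator)
    also have "\<dots> = ((\<integral>x. indicat_real U (x + v) \<partial>lborel) - (\<integral>x. indicat_real U x \<partial>lborel))
       + 2 * (\<integral>x. indicat_real U x * (1 - indicat_real U (x + v)) \<partial>lborel)"
      using int int' int2 by simp
    finally show ?thesis
      by (simp add: integral_lborel_shift)
  qed
  have "((\<lambda>v. \<integral>x. indicat_real U x * (1 - indicat_real U (x + v)) \<partial>lborel) \<longlongrightarrow> 0) (at 0)"
    unfolding tendsto_at_iff_sequentially comp_def
  proof (intro allI impI)
    fix X :: "nat \<Rightarrow> 'a" assume X: "X \<longlonglongrightarrow> 0"
    have "(\<lambda>n. \<integral>x. indicat_real U x * (1 - indicat_real U (x + X n)) \<partial>lborel) \<longlonglongrightarrow> (\<integral>x. (0::real)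
        \<partial>(lborel::'a measure))"
    proof (rule integral_dominated_convergence[OF _ _ int])
      show "AE x in lborel. (\<lambda>n. indicat_real U x * (1 - indicat_real U (x + X n))) \<longlonglongrightarrow> 0"
      proof (rule AE_I2)
        fix x :: 'a
        show "(\<lambda>n. indicat_real U x * (1 - indicat_real U (x + X n))) \<longlonglongrightarrow> 0"
        proof (cases "x \<in> U")
          case True
          have "(\<lambda>n. x + X n) \<longlonglongrightarrow> x" using tendsto_add[OF tendsto_const X, of x] by simp
          then have "eventually (\<lambda>n. x + X n \<in> U) sequentially"
            using topological_tendstoD \<open>open U\<close> True by blast
          then have "eventually (\<lambda>n. indicat_real U x * (1 - indicat_real U (x + X n)) =
              0) sequentially"
            by eventually_elim simp
          then show ?thesis by (rule tendsto_eventually)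
        qed simp
      qed
    qed (auto split: split_indicator)
    then show "(\<lambda>n. \<integral>x. indicat_real U x * (1 - indicat_real U (x + X n)) \<partial>lborel) \<longlonglongrightarrow> 0" by simp
  qed
  from tendsto_mult_left[OF this, of 2] show ?thesis unfolding eq by simp
qed

text \<open>Translation is an isometry of \<open>L\<^sup>1\<close>, so the property passes to
  \<open>L\<^sup>1\<close> limits by a three-term estimate.\<close>

lemma L1_translation_continuous_approx:
  fixes f :: "'a::euclidean_space \<Rightarrow> real"
  assumes f: "integrable lborel f"
    and approx: "\<And>e. e > 0 \<Longrightarrow> \<exists>g. integrable lborel g \<and> (\<integral>x. \<bar>f x - g x\<bar> \<partial>lborel) < e \<and>
        ((\<lambda>v. \<integral>x. \<bar>g (x + v) - g x\<bar> \<partial>lborel) \<longlongrightarrow> 0) (at 0)"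
  shows "((\<lambda>v. \<integral>x. \<bar>f (x + v) - f x\<bar> \<partial>lborel) \<longlongrightarrow> 0) (at 0)"
proof (rule tendstoI)
  fix e :: real assume "e > 0"
  then obtain g where g: "integrable lborel g" "(\<integral>x. \<bar>f x - g x\<bar> \<partial>lborel) < e / 4"
      and lim: "((\<lambda>v. \<integral>x. \<bar>g (x + v) - g x\<bar> \<partial>lborel) \<longlongrightarrow> 0) (at 0)"
    using approx[of "e/4"] by auto
  have [measurable]: "f \<in> borel_measurable borel" "g \<in> borel_measurable borel"
    using borel_measurable_integrable[OF f] borel_measurable_integrable[OF g(1)] by simp_all
  note ints = f g(1) integrable_lborel_shift[OF f] integrable_lborel_shift[OF g(1)]
  have "eventually (\<lambda>v. dist (\<integral>x. \<bar>g (x + v) - g x\<bar> \<partial>lborel) 0 < e / 4) (at 0)"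
    using tendstoD[OF lim, of "e/4"] \<open>e > 0\<close> by simp
  then show "eventually (\<lambda>v. dist (\<integral>x. \<bar>f (x + v) - f x\<bar> \<partial>lborel) 0 < e) (at 0)"
  proof eventually_elim
    case (elim v)
    have "(\<integral>x. \<bar>f (x + v) - f x\<bar> \<partial>lborel) \<le>
       (\<integral>x. \<bar>f (x + v) - g (x + v)\<bar> + \<bar>g (x + v) - g x\<bar> + \<bar>f x - g x\<bar> \<partial>lborel)"
      by (rule integral_mono) (use ints in auto)
    also have "\<dots> = (\<integral>x. \<bar>f (x + v) - g (x + v)\<bar> \<partial>lborel) + (\<integral>x. \<bar>g (x + v) - g x\<bar> \<partial>lborel) + (\<integral>x. \<bar>f
        x - g x\<bar> \<partial>lborel)"
      using ints by simp
    also have "(\<integral>x. \<bar>f (x + v) - g (x + v)\<bar> \<partial>lborel) = (\<integral>x. \<bar>f x - g x\<bar> \<partial>lborel)"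
      by (rule integral_lborel_shift[where f="\<lambda>x. \<bar>f x - g x\<bar>"]) simp
    finally show ?case using elim g(2) \<open>e > 0\<close> by simp
  qed
qed

lemma L1_translation_continuous:
  fixes f :: "'a::euclidean_space \<Rightarrow> real"
  assumes "integrable lborel f"
  shows "((\<lambda>v. \<integral>x. \<bar>f (x + v) - f x\<bar> \<partial>lborel) \<longlongrightarrow> 0) (at 0)"
  using assms
proof (induction rule: integrable_induct)
  case (base A c)
  then have [measurable]: "A \<in> sets borel" by simp
  have "((\<lambda>v. \<integral>x. \<bar>indicat_real A (x + v) - indicat_real A x\<bar> \<partial>lborel) \<longlongrightarrow> 0) (at 0)"
  proof (rule L1_translation_continuous_approx)
    show "integrable lborel (indicat_real A)" using base by simp
    fix e :: real assume "e > 0"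
    \<comment> \<open>Outer regularity reduces a set of finite measure to the open case.\<close>
    obtain U where U: "open U" "A \<subseteq> U" "emeasure lborel (U - A) < ennreal e"
      using outer_regular_lborel[of A e] \<open>e > 0\<close> by auto
    have [measurable]: "U \<in> sets borel" using U by auto
    have "emeasure lborel U = emeasure lborel A + emeasure lborel (U - A)"
      using U by (subst plus_emeasure) (auto simp: Un_absorb1)
    also have "\<dots> < \<infinity>" using base U(3) by (simp add: less_top[symmetric]) (metis ennreal_less_top
        less_top order_less_trans)
    finally have finU: "emeasure lborel U < \<infinity>" .
    have "(\<integral>x. \<bar>indicat_real A x - indicat_real U x\<bar> \<partial>lborel) = (\<integral>x. indicat_real (U - A) x
        \<partial>lborel)"
      using U(2) by (intro Bochner_Integration.integral_cong) (auto split: split_indicator)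
    also have "\<dots> < e"
      using U(3) \<open>e > 0\<close> by (simp add: measure_def) (metis U(3) enn2real_less_iff ennreal_less_top
          less_top order_less_trans enn2real_nonneg ennreal_enn2real ennreal_less_iff)
    finally show "\<exists>g. integrable lborel g \<and> (\<integral>x. \<bar>indicat_real A x - g x\<bar> \<partial>lborel) < e \<and>
        ((\<lambda>v. \<integral>x. \<bar>g (x + v) - g x\<bar> \<partial>lborel) \<longlongrightarrow> 0) (at 0)"
      using L1_translation_continuous_open[OF U(1) finU] finU
      by (intro exI[of _ "indicat_real U"]) auto
  qed
  from tendsto_mult_left[OF this, of "\<bar>c\<bar>"]
  have "((\<lambda>v. \<bar>c\<bar> * (\<integral>x. \<bar>indicat_real A (x + v) - indicat_real A x\<bar> \<partial>lborel)) \<longlongrightarrow> 0) (at 0)" by simp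
  moreover have "\<bar>c\<bar> * (\<integral>x. \<bar>indicat_real A (x + v) - indicat_real A x\<bar> \<partial>lborel) =
      (\<integral>x. \<bar>indicat_real A (x + v) *\<^sub>R c - indicat_real A x *\<^sub>R c\<bar> \<partial>lborel)" for v
    by (subst integral_mult_right_zero[symmetric], rule Bochner_Integration.integral_cong)
       (auto split: split_indicator)
  ultimately show ?case by simp
next
  case (add f g)
  note ints = add.hyps integrable_lborel_shift[OF add.hyps(1)] integrable_lborel_shift[OF
      add.hyps(2)]
  have lim: "((\<lambda>v. (\<integral>x. \<bar>f (x + v) - f x\<bar> \<partial>lborel) + (\<integral>x. \<bar>g (x + v) - g x\<bar> \<partial>lborel)) \<longlongrightarrow> 0) (at 0)"
    using tendsto_add[OF add.IH(1) add.IH(2)] by simp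
  show ?case
  proof (rule tendsto_sandwich[OF _ _ tendsto_const lim], goal_cases)
    case 2
    show ?case
    proof (rule always_eventually, rule allI)
      fix v
      have "(\<integral>x. \<bar>f (x + v) + g (x + v) - (f x + g x)\<bar> \<partial>lborel) \<le> (\<integral>x. \<bar>f (x + v) - f x\<bar> + \<bar>g (x +
          v) - g x\<bar> \<partial>lborel)"
        by (rule integral_mono) (use ints in auto)
      also have "\<dots> = (\<integral>x. \<bar>f (x + v) - f x\<bar> \<partial>lborel) + (\<integral>x. \<bar>g (x + v) - g x\<bar> \<partial>lborel)"
        using ints by simp
      finally show "(\<integral>x. \<bar>f (x + v) + g (x + v) - (f x + g x)\<bar> \<partial>lborel) \<le>
          (\<integral>x. \<bar>f (x + v) - f x\<bar> \<partial>lborel) + (\<integral>x. \<bar>g (x + v) - g x\<bar> \<partial>lborel)" .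
    qed
  qed simp
next
  case (lim f s)
  show ?case
  proof (rule L1_translation_continuous_approx[OF lim.hyps(4)])
    fix e :: real assume "e > 0"
    have [measurable]: "f \<in> borel_measurable borel" "s i \<in> borel_measurable borel" for i
      using borel_measurable_integrable[OF lim.hyps(4)] borel_measurable_integrable[OF lim.hyps(1)]
        by simp_all
    have "(\<lambda>i. \<integral>x. \<bar>f x - s i x\<bar> \<partial>lborel) \<longlonglongrightarrow> (\<integral>x. (0::real) \<partial>(lborel::'a measure))"
    proof (rule integral_dominated_convergence[where w="\<lambda>x. 3 * \<bar>f x\<bar>"])
      show "AE x in lborel. (\<lambda>i. \<bar>f x - s i x\<bar>) \<longlonglongrightarrow> 0"
      proof (rule AE_I2)
        fix x
        have "(\<lambda>i. f x - s i x) \<longlonglongrightarrow> f x - f x" using lim.hyps(2) by (intro tendsto_intros) auto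
        then show "(\<lambda>i. \<bar>f x - s i x\<bar>) \<longlonglongrightarrow> 0" by (simp add: tendsto_rabs_zero)
      qed
      show "AE x in lborel. norm \<bar>f x - s i x\<bar> \<le> 3 * \<bar>f x\<bar>" for i
      proof (rule AE_I2)
        fix x show "norm \<bar>f x - s i x\<bar> \<le> 3 * \<bar>f x\<bar>" using lim.hyps(3)[of x i] by simp
      qed
    qed (use lim.hyps(4) in auto)
    then have "eventually (\<lambda>i. (\<integral>x. \<bar>f x - s i x\<bar> \<partial>lborel) < e) sequentially"
      using \<open>e > 0\<close> by (intro order_tendstoD) auto
    then obtain i where "(\<integral>x. \<bar>f x - s i x\<bar> \<partial>lborel) < e"
      by (auto simp: eventually_sequentially)
    then show "\<exists>g. integrable lborel g \<and> (\<integral>x. \<bar>f x - g x\<bar> \<partial>lborel) < e \<and>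
        ((\<lambda>v. \<integral>x. \<bar>g (x + v) - g x\<bar> \<partial>lborel) \<longlongrightarrow> 0) (at 0)"
      using lim.hyps(1) lim.IH by (intro exI[of _ "s i"]) auto
  qed
qed

section \<open>Averages over a measure on the unit sphere\<close>

text \<open>The averaging argument uses only these properties of the arc; curvature enters through
  absolute continuity of the difference law.\<close>

locale sphere_measure =
  fixes \<mu> :: "'a::euclidean_space measure"
  assumes prob: "prob_space \<mu>"
    and sets_mu [measurable_cong, simp]: "sets \<mu> = sets borel"
    and AE_norm: "AE y in \<mu>. norm y = 1"
    and ac: "absolutely_continuous lborel (distr (\<mu> \<Otimes>\<^sub>M \<mu>) borel (\<lambda>(y, z). y - z))"
begin

sublocale prob_space \<mu> by (rule prob)

sublocale PL: pair_sigma_finite lborel \<mu> ..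
sublocale PP: pair_prob_space \<mu> \<mu> ..

lemma space_mu [simp]: "space \<mu> = UNIV"
  using sets_eq_imp_space_eq[OF sets_mu] by simp

definition avg :: "real \<Rightarrow> ('a \<Rightarrow> real) \<Rightarrow> 'a \<Rightarrow> real" where
  "avg r f x = (\<integral>y. f (x + r *\<^sub>R y) \<partial>\<mu>)"

definition dif :: "real \<Rightarrow> ('a \<Rightarrow> real) \<Rightarrow> 'a \<Rightarrow> real" where
  "dif r f x = avg r f x - f x"

text \<open>Pairings are estimated by a supremum bound on one factor and an \<open>L\<^sup>1\<close>
  bound on the other. \<open>bdd\<close> and \<open>adm\<close> carry these bounds as explicit
  constants because the final estimates must be uniform in the function.\<close>

definition bdd :: "real \<Rightarrow> ('a \<Rightarrow> real) \<Rightarrow> bool" where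
  "bdd C f \<longleftrightarrow> f \<in> borel_measurable borel \<and> (\<forall>x. \<bar>f x\<bar> \<le> C)"

definition adm :: "real \<Rightarrow> real \<Rightarrow> ('a \<Rightarrow> real) \<Rightarrow> bool" where
  "adm C m f \<longleftrightarrow> bdd C f \<and> integrable lborel f \<and> (\<integral>x. \<bar>f x\<bar> \<partial>lborel) \<le> m"

lemma bdd_measurable: "bdd C f \<Longrightarrow> f \<in> borel_measurable borel"
  and bdd_bound: "bdd C f \<Longrightarrow> \<bar>f x\<bar> \<le> C"
  by (auto simp: bdd_def)

lemma bdd_bound_abs: "bdd C f \<Longrightarrow> \<bar>f x\<bar> \<le> \<bar>C\<bar>"
  using bdd_bound[of C f x] by linarith

lemma adm_bdd: "adm C m f \<Longrightarrow> bdd C f"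
  and adm_integrable: "adm C m f \<Longrightarrow> integrable lborel f"
  and adm_L1: "adm C m f \<Longrightarrow> (\<integral>x. \<bar>f x\<bar> \<partial>lborel) \<le> m"
  by (auto simp: adm_def)

lemma bdd_integrable_mu:
  assumes "bdd C f"
  shows "integrable \<mu> (\<lambda>y. f (x + r *\<^sub>R y))"
proof -
  have [measurable]: "f \<in> borel_measurable borel" using assms by (rule bdd_measurable)
  show ?thesis
    by (rule integrable_const_bound[where B=C]) (use bdd_bound[OF assms] in auto)
qed

lemma avg_bdd:
  assumes "bdd C f"
  shows "bdd C (avg r f)"
proof -
  have [measurable]: "f \<in> borel_measurable borel" using assms by (rule bdd_measurable)
  have "\<bar>avg r f x\<bar> \<le> C" for x
  proof -
    have "\<bar>avg r f x\<bar> \<le> (\<integral>y. \<bar>f (x + r *\<^sub>R y)\<bar> \<partial>\<mu>)"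
      unfolding avg_def by (rule integral_abs_bound)
    also have "\<dots> \<le> C"
      by (rule integral_le_const) (use bdd_integrable_mu[OF assms] bdd_bound[OF assms] in auto)
    finally show ?thesis .
  qed
  moreover have "avg r f \<in> borel_measurable borel"
    unfolding avg_def[abs_def] by measurable
  ultimately show ?thesis by (simp add: bdd_def)
qed

text \<open>Integrating over \<open>x\<close> first, translation invariance removes the shift by
  \<open>r *\<^sub>R y\<close>, and the total mass of \<open>\<mu>\<close> is one.\<close>

lemma integrable_shear:
  fixes f :: "'a \<Rightarrow> real"
  assumes f: "integrable lborel f"
  shows "integrable (lborel \<Otimes>\<^sub>M \<mu>) (\<lambda>(x, y). f (x + r *\<^sub>R y))"
    and "integral\<^sup>L (lborel \<Otimes>\<^sub>M \<mu>) (\<lambda>(x, y). f (x + r *\<^sub>R y)) = integral\<^sup>L lborel f"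
proof -
  have [measurable]: "f \<in> borel_measurable borel" using borel_measurable_integrable[OF f] by simp
  have "(\<integral>\<^sup>+z. ennreal (norm ((\<lambda>(x, y). f (x + r *\<^sub>R y)) z)) \<partial>(lborel \<Otimes>\<^sub>M \<mu>)) =
     (\<integral>\<^sup>+y. \<integral>\<^sup>+x. ennreal (norm (f (x + r *\<^sub>R y))) \<partial>lborel \<partial>\<mu>)"
    by (subst PL.nn_integral_snd[symmetric]) simp_all
  also have "\<dots> = (\<integral>\<^sup>+y. \<integral>\<^sup>+x. ennreal (norm (f x)) \<partial>lborel \<partial>\<mu>)"
    by (subst nn_integral_lborel_shift) simp_all
  also have "\<dots> = (\<integral>\<^sup>+x. ennreal (norm (f x)) \<partial>lborel)"
    by (simp add: emeasure_space_1[simplified])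
  also have "\<dots> < \<infinity>" by (rule conjunct2[OF f[unfolded Bochner_Integration.integrable_iff_bounded]])
  finally show int: "integrable (lborel \<Otimes>\<^sub>M \<mu>) (\<lambda>(x, y). f (x + r *\<^sub>R y))"
    by (intro integrableI_bounded) simp_all
  have "integral\<^sup>L (lborel \<Otimes>\<^sub>M \<mu>) (\<lambda>(x, y). f (x + r *\<^sub>R y)) = (\<integral>y. \<integral>x. f (x + r *\<^sub>R y) \<partial>lborel \<partial>\<mu>)"
    using PL.integral_snd[OF int] by simp
  also have "\<dots> = integral\<^sup>L lborel f"
    by (subst integral_lborel_shift) (simp_all add: prob_space[simplified])
  finally show "integral\<^sup>L (lborel \<Otimes>\<^sub>M \<mu>) (\<lambda>(x, y). f (x + r *\<^sub>R y)) = integral\<^sup>L lborel f" .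
qed

lemma avg_integrable:
  assumes f: "integrable lborel f"
  shows "integrable lborel (avg r f)" and "integral\<^sup>L lborel (avg r f) = integral\<^sup>L lborel f"
  using PL.integrable_fst'[OF integrable_shear(1)[OF f, of r]] PL.integral_fst'[OF
      integrable_shear(1)[OF f, of r]]
    integrable_shear(2)[OF f, of r]
  by (simp_all add: avg_def[abs_def])

lemma abs_avg_le: "\<bar>avg r f x\<bar> \<le> avg r (\<lambda>x. \<bar>f x\<bar>) x"
  unfolding avg_def by (rule integral_abs_bound)

lemma avg_adm:
  assumes "adm C m f"
  shows "adm C m (avg r f)"
proof -
  note b = adm_bdd[OF assms] and i = adm_integrable[OF assms]
  have "(\<integral>x. \<bar>avg r f x\<bar> \<partial>lborel) \<le> (\<integral>x. avg r (\<lambda>x. \<bar>f x\<bar>) x \<partial>lborel)"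
    by (rule integral_mono) (use avg_integrable(1)[of f] avg_integrable(1)[of "\<lambda>x. \<bar>f x\<bar>"] i in
        \<open>auto intro: abs_avg_le\<close>)
  also have "\<dots> = (\<integral>x. \<bar>f x\<bar> \<partial>lborel)" using i by (simp add: avg_integrable(2))
  also have "\<dots> \<le> m" by (rule adm_L1[OF assms])
  finally show ?thesis using avg_bdd[OF b] avg_integrable(1)[OF i] by (simp add: adm_def)
qed

lemma adm_diff:
  assumes "adm C m f" "adm D k g"
  shows "adm (C + D) (m + k) (\<lambda>x. f x - g x)"
proof -
  note i = adm_integrable[OF assms(1)] adm_integrable[OF assms(2)]
  have "(\<integral>x. \<bar>f x - g x\<bar> \<partial>lborel) \<le> (\<integral>x. \<bar>f x\<bar> + \<bar>g x\<bar> \<partial>lborel)"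
    by (rule integral_mono) (use i in auto)
  also have "\<dots> \<le> m + k" using i adm_L1[OF assms(1)] adm_L1[OF assms(2)] by simp
  finally show ?thesis
    using assms i unfolding adm_def bdd_def
    by (auto intro: order_trans[OF abs_triangle_ineq4] add_mono)
qed

lemma dif_adm: "adm C m f \<Longrightarrow> adm (2 * C) (2 * m) (dif r f)"
  using adm_diff[OF avg_adm, of C m f C m f r] by (simp add: dif_def[abs_def])

lemma dif_bdd: "bdd C f \<Longrightarrow> bdd (2 * C) (dif r f)"
  using avg_bdd[of C f r] unfolding bdd_def dif_def[abs_def]
  by (auto intro!: order_trans[OF abs_triangle_ineq4] add_mono[of _ C _ C, simplified])

lemma avg_diff:
  assumes "bdd C f" "bdd D g"
  shows "avg r (\<lambda>x. f x - g x) x = avg r f x - avg r g x"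
  unfolding avg_def using assms by (simp add: bdd_integrable_mu)

lemma avg_mono:
  assumes "bdd C f" "bdd D g" "\<And>x. f x \<le> g x"
  shows "avg r f x \<le> avg r g x"
  unfolding avg_def using assms by (intro integral_mono bdd_integrable_mu) auto

lemma avg_avg:
  assumes "bdd C f"
  shows "integrable (\<mu> \<Otimes>\<^sub>M \<mu>) (\<lambda>(y, z). f (x + r *\<^sub>R y + s *\<^sub>R z))"
    and "avg r (avg s f) x = (\<integral>p. f (x + r *\<^sub>R fst p + s *\<^sub>R snd p) \<partial>(\<mu> \<Otimes>\<^sub>M \<mu>))"
proof -
  have [measurable]: "f \<in> borel_measurable borel" using assms by (rule bdd_measurable)
  show int: "integrable (\<mu> \<Otimes>\<^sub>M \<mu>) (\<lambda>(y, z). f (x + r *\<^sub>R y + s *\<^sub>R z))"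
    by (rule PP.P.integrable_const_bound[where B=C]) (use bdd_bound[OF assms] in auto)
  show "avg r (avg s f) x = (\<integral>p. f (x + r *\<^sub>R fst p + s *\<^sub>R snd p) \<partial>(\<mu> \<Otimes>\<^sub>M \<mu>))"
    using PP.integral_fst'[OF int] unfolding avg_def by (simp add: case_prod_beta')
qed

lemma avg_commute:
  assumes "bdd C f"
  shows "avg r (avg s f) = avg s (avg r f)"
proof
  fix x
  have "avg r (avg s f) x = (\<integral>y. \<integral>z. f (x + r *\<^sub>R y + s *\<^sub>R z) \<partial>\<mu> \<partial>\<mu>)"
    by (simp add: avg_def)
  also have "\<dots> = (\<integral>z. \<integral>y. f (x + r *\<^sub>R y + s *\<^sub>R z) \<partial>\<mu> \<partial>\<mu>)"
    using PP.Fubini_integral[of "\<lambda>y z. f (x + r *\<^sub>R y + s *\<^sub>R z)"] avg_avg(1)[OF assms, of x r s]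
      by simp
  also have "\<dots> = avg s (avg r f) x"
    by (simp add: avg_def add_ac)
  finally show "avg r (avg s f) x = avg s (avg r f) x" .
qed

lemma avg_dif_commute:
  assumes "bdd C f"
  shows "avg r (dif s f) = dif s (avg r f)"
  using avg_diff[OF avg_bdd[OF assms, of s] assms, of r] avg_commute[OF assms, of r s]
  by (auto simp: dif_def[abs_def] fun_eq_iff)

lemma dif_dif_commute:
  assumes "bdd C f"
  shows "dif r (dif s f) = dif s (dif r f)"
  using avg_dif_commute[OF assms, of r s] avg_dif_commute[OF assms, of s r] avg_commute[OF assms, of
      r s]
  unfolding dif_def[abs_def] fun_eq_iff by (auto simp: dif_def[abs_def] algebra_simps)

lemma integrable_mult_bdd:
  assumes "integrable lborel f" "bdd C g"
  shows "integrable lborel (\<lambda>x. f x * g x)"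
proof -
  have [measurable]: "f \<in> borel_measurable borel" "g \<in> borel_measurable borel"
    using borel_measurable_integrable[OF assms(1)] bdd_measurable[OF assms(2)] by simp_all
  have "integrable lborel (\<lambda>x. f x * C)" using assms by simp
  then show ?thesis
    by (rule Bochner_Integration.integrable_bound)
       (auto simp: abs_mult intro!: mult_left_mono bdd_bound_abs[OF assms(2)])
qed

text \<open>Replacing \<open>x\<close> by \<open>x - r *\<^sub>R y\<close> inside the double
  integral turns a forward shift of \<open>f\<close> into a backward shift of \<open>g\<close>. Both
  uses of Fubini are justified by bounding one factor and integrating the other, shifted
  one.\<close>

lemma avg_adjoint:
  assumes f: "adm C m f" and g: "adm D k g"
  shows "(\<integral>x. avg r f x * g x \<partial>lborel) = (\<integral>x. f x * avg (-r) g x \<partial>lborel)"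
proof -
  have [measurable]: "f \<in> borel_measurable borel" "g \<in> borel_measurable borel"
    using bdd_measurable adm_bdd f g by blast+
  have "integrable (lborel \<Otimes>\<^sub>M \<mu>) (\<lambda>(x, y). f (x + r *\<^sub>R y) * D)"
    using integrable_mult_left[OF integrable_shear(1)[OF adm_integrable[OF f], of r], of D]
    by (simp add: case_prod_beta')
  then have int: "integrable (lborel \<Otimes>\<^sub>M \<mu>) (\<lambda>(x, y). f (x + r *\<^sub>R y) * g x)"
    by (rule Bochner_Integration.integrable_bound)
       (auto simp: abs_mult intro!: AE_I2 mult_left_mono bdd_bound_abs[OF adm_bdd[OF g]])
  have "(\<integral>x. avg r f x * g x \<partial>lborel) = (\<integral>x. \<integral>y. f (x + r *\<^sub>R y) * g x \<partial>\<mu> \<partial>lborel)"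
    by (simp add: avg_def)
  also have "\<dots> = (\<integral>y. \<integral>x. f (x + r *\<^sub>R y) * g x \<partial>lborel \<partial>\<mu>)"
    using PL.Fubini_integral[of "\<lambda>x y. f (x + r *\<^sub>R y) * g x"] int by simp
  also have "\<dots> = (\<integral>y. \<integral>x. f x * g (x + (-r) *\<^sub>R y) \<partial>lborel \<partial>\<mu>)"
    using integral_lborel_shift[of "\<lambda>x. f x * g (x + (-r) *\<^sub>R y)" "r *\<^sub>R y" for y] by simp
  also have "\<dots> = (\<integral>x. \<integral>y. f x * g (x + (-r) *\<^sub>R y) \<partial>\<mu> \<partial>lborel)"
  proof -
    have "integrable (lborel \<Otimes>\<^sub>M \<mu>) (\<lambda>(x, y). C * g (x + (-r) *\<^sub>R y))"
      using integrable_mult_right[OF integrable_shear(1)[OF adm_integrable[OF g], of "-r"], of C]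
      by (simp add: case_prod_beta')
    then have "integrable (lborel \<Otimes>\<^sub>M \<mu>) (\<lambda>(x, y). f x * g (x + (-r) *\<^sub>R y))"
      by (rule Bochner_Integration.integrable_bound)
         (auto simp: abs_mult intro!: AE_I2 mult_right_mono bdd_bound_abs[OF adm_bdd[OF f]])
    then show ?thesis
      using PL.Fubini_integral[of "\<lambda>x y. f x * g (x + (-r) *\<^sub>R y)"] by simp
  qed
  also have "\<dots> = (\<integral>x. f x * avg (-r) g x \<partial>lborel)"
    by (simp add: avg_def)
  finally show ?thesis .
qed

lemma dif_adjoint:
  assumes f: "adm C m f" and g: "adm D k g"
  shows "(\<integral>x. dif r f x * g x \<partial>lborel) = (\<integral>x. f x * dif (-r) g x \<partial>lborel)"
proof -
  note i = integrable_mult_bdd[OF adm_integrable[OF f] adm_bdd[OF g]]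
    integrable_mult_bdd[OF adm_integrable[OF avg_adm[OF f]] adm_bdd[OF g], of r]
    integrable_mult_bdd[OF adm_integrable[OF f] adm_bdd[OF avg_adm[OF g]], of "-r"]
  show ?thesis
    using avg_adjoint[OF f g, of r] i by (simp add: dif_def algebra_simps)
qed

section \<open>Equicontinuity of double averages\<close>

text \<open>The double average integrates \<open>f (x + r *\<^sub>R (y - z))\<close> over
  independent \<open>y\<close> and \<open>z\<close>, and \<open>D\<close> is the Radon-Nikodym
  density of the law of \<open>y - z\<close>. One \<open>D\<close> serves all \<open>f\<close>,
  \<open>r\<close> and \<open>x\<close>, since \<open>r\<close> only scales the argument of
  \<open>f\<close>.\<close>

lemma difference_density:
  "\<exists>D :: 'a \<Rightarrow> real. integrable lborel D \<and>
    (\<forall>f r x C. bdd C f \<longrightarrow> integrable lborel (\<lambda>w. D w * f (x + r *\<^sub>R w)) \<and>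
        avg r (avg (-r) f) x = (\<integral>w. D w * f (x + r *\<^sub>R w) \<partial>lborel))"
proof -
  define N where "N = distr (\<mu> \<Otimes>\<^sub>M \<mu>) borel (\<lambda>(y, z). y - z)"
  have sets_N [simp, measurable_cong]: "sets N = sets borel" by (simp add: N_def)
  interpret N: prob_space N
    unfolding N_def by (rule PP.P.prob_space_distr) measurable
  have "absolutely_continuous lborel N" using ac by (simp add: N_def)
  from sigma_finite_measure.real_RN_deriv[OF sigma_finite_lborel N.finite_measure_axioms this]
      obtain D where
    D: "D \<in> borel_measurable lborel" "AE x in lborel. RN_deriv lborel N x = ennreal (D x)" "\<And>x. 0 \<le>
        D x"
    by auto
  have [measurable]: "D \<in> borel_measurable borel" using D(1) by simp
  have dens: "N = density lborel (\<lambda>x. ennreal (D x))"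
  proof -
    have "N = density lborel (RN_deriv lborel N)"
      using \<open>absolutely_continuous lborel N\<close> by (simp add: sigma_finite_measure.density_RN_deriv[OF
          sigma_finite_lborel])
    also have "\<dots> = density lborel (\<lambda>x. ennreal (D x))"
      using D(2) by (intro density_cong) auto
    finally show ?thesis .
  qed
  have int: "integrable lborel (\<lambda>w. D w * f (x + r *\<^sub>R w))" if b: "bdd C f" for f C r x
  proof -
    have [measurable]: "f \<in> borel_measurable borel" using bdd_measurable[OF b] .
    have "integrable N (\<lambda>w. f (x + r *\<^sub>R w))"
      by (rule N.integrable_const_bound[where B=C]) (use bdd_bound[OF b] in auto)
    then show ?thesis unfolding dens using D(3) by (subst (asm) integrable_density) auto
  qed
  have "integrable lborel D"
    using int[of 1 "\<lambda>_. 1"] by (simp add: bdd_def)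
  moreover have "avg r (avg (-r) f) x = (\<integral>w. D w * f (x + r *\<^sub>R w) \<partial>lborel)"
    if b: "bdd C f" for f C r x
  proof -
    have [measurable]: "f \<in> borel_measurable borel" using bdd_measurable[OF b] .
    have "avg r (avg (-r) f) x = (\<integral>p. f (x + r *\<^sub>R (fst p - snd p)) \<partial>(\<mu> \<Otimes>\<^sub>M \<mu>))"
      by (simp add: avg_avg(2)[OF b] scaleR_diff_right add_diff_eq)
    also have "\<dots> = (\<integral>w. f (x + r *\<^sub>R w) \<partial>N)"
      unfolding N_def by (subst integral_distr) (auto simp: case_prod_beta')
    also have "\<dots> = (\<integral>w. D w * f (x + r *\<^sub>R w) \<partial>lborel)"
      unfolding dens using D(3) by (subst integral_density) auto
    finally show ?thesis .
  qed
  ultimately show ?thesis using int by (intro exI[of _ D] conjI allI impI) auto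
qed

text \<open>Moving the point by \<open>v\<close> amounts to shifting the argument of
  \<open>D\<close> by \<open>- (v /\<^sub>R r)\<close>. Continuity of translations, applied to
  \<open>D\<close> alone, therefore gives an \<open>\<eta>\<close> independent of \<open>f\<close>,
  \<open>r\<close> and \<open>x\<close>.\<close>

lemma avg_avg_equicontinuous:
  fixes e :: real
  assumes "e > 0"
  obtains \<eta> where "\<eta> > 0"
    "\<And>f r x v. bdd 1 f \<Longrightarrow> r > 0 \<Longrightarrow> norm v \<le> \<eta> * r \<Longrightarrow>
       \<bar>avg r (avg (-r) f) (x + v) - avg r (avg (-r) f) x\<bar> \<le> e"
proof -
  obtain D :: "'a \<Rightarrow> real" where D: "integrable lborel D"
    "\<And>f r x C. bdd C f \<Longrightarrow> integrable lborel (\<lambda>w. D w * f (x + r *\<^sub>R w)) \<and>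
        avg r (avg (-r) f) x = (\<integral>w. D w * f (x + r *\<^sub>R w) \<partial>lborel)"
    using difference_density by metis
  have [measurable]: "D \<in> borel_measurable borel" using borel_measurable_integrable[OF D(1)] by simp
  have "eventually (\<lambda>v. dist (\<integral>x. \<bar>D (x + v) - D x\<bar> \<partial>lborel) 0 < e) (at 0)"
    using tendstoD[OF L1_translation_continuous[OF D(1)] assms] .
  then obtain d where d: "d > 0" "\<And>v. v \<noteq> 0 \<Longrightarrow> dist v 0 < d \<Longrightarrow> dist (\<integral>x. \<bar>D (x + v) - D x\<bar> \<partial>lborel) 0
      < e"
    unfolding eventually_at by auto
  have small: "(\<integral>x. \<bar>D (x + v) - D x\<bar> \<partial>lborel) \<le> e" if "norm v < d" for v
    using d(2)[of v] that assms by (cases "v = 0") auto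
  show ?thesis
  \<comment> \<open>Halving \<open>d\<close> turns the non-strict bound on \<open>norm v\<close>
    into the strict one that \<open>small\<close> asks for.\<close>
  proof (rule that[of "d / 2"])
    show "d / 2 > 0" using d(1) by simp
    fix f :: "'a \<Rightarrow> real" and r :: real and x v :: 'a
    assume f: "bdd 1 f" and r: "r > 0" and v: "norm v \<le> d / 2 * r"
    have [measurable]: "f \<in> borel_measurable borel" using bdd_measurable[OF f] .
    define u where "u = - (v /\<^sub>R r)"
    have nu: "norm u < d" using v r mult_pos_pos[OF d(1) r] by (simp add: u_def field_simps)
    have vu: "v = - (r *\<^sub>R u)" using r by (simp add: u_def)
    have shift: "x + v + r *\<^sub>R (w + u) = x + r *\<^sub>R w" for w
      unfolding vu by (simp add: scaleR_add_right)
    have "avg r (avg (-r) f) (x + v) = (\<integral>w. D w * f (x + v + r *\<^sub>R w) \<partial>lborel)"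
      using D(2)[OF f] by blast
    also have "\<dots> = (\<integral>w. D (w + u) * f (x + v + r *\<^sub>R (w + u)) \<partial>lborel)"
      by (rule integral_lborel_shift[of "\<lambda>w. D w * f (x + v + r *\<^sub>R w)" u, symmetric]) measurable
    also have "\<dots> = (\<integral>w. D (w + u) * f (x + r *\<^sub>R w) \<partial>lborel)"
      unfolding shift ..
    finally have 1: "avg r (avg (-r) f) (x + v) = (\<integral>w. D (w + u) * f (x + r *\<^sub>R w) \<partial>lborel)" .
    have i1: "integrable lborel (\<lambda>w. D (w + u) * f (x + r *\<^sub>R w))"
    proof -
      have "integrable lborel (\<lambda>w. D w * f (x + v + r *\<^sub>R w))" using D(2)[OF f] by blast
      from integrable_lborel_shift[OF this, of u] show ?thesis unfolding shift .
    qed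
    have "\<bar>avg r (avg (-r) f) (x + v) - avg r (avg (-r) f) x\<bar> =
       \<bar>\<integral>w. (D (w + u) - D w) * f (x + r *\<^sub>R w) \<partial>lborel\<bar>"
      using 1 i1 D(2)[OF f, of x r] by (simp add: left_diff_distrib)
    also have "\<dots> \<le> (\<integral>w. \<bar>(D (w + u) - D w) * f (x + r *\<^sub>R w)\<bar> \<partial>lborel)"
      by (rule integral_abs_bound)
    also have "\<dots> \<le> (\<integral>w. \<bar>D (w + u) - D w\<bar> \<partial>lborel)"
    proof (rule integral_mono)
      show "integrable lborel (\<lambda>w. \<bar>(D (w + u) - D w) * f (x + r *\<^sub>R w)\<bar>)"
        using i1 D(2)[OF f, of x r] by (simp add: left_diff_distrib)
      show "integrable lborel (\<lambda>w. \<bar>D (w + u) - D w\<bar>)"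
        using D(1) integrable_lborel_shift[OF D(1)] by simp
      show "\<bar>(D (w + u) - D w) * f (x + r *\<^sub>R w)\<bar> \<le> \<bar>D (w + u) - D w\<bar>" for w
        using bdd_bound[OF f] by (simp add: abs_mult mult_left_le)
    qed
    also have "\<dots> \<le> e" by (rule small[OF nu])
    finally show "\<bar>avg r (avg (-r) f) (x + v) - avg r (avg (-r) f) x\<bar> \<le> e" .
  qed
qed

text \<open>\<open>dif s\<close> averages increments over steps of length \<open>s\<close>, which is
  at most \<open>\<eta> * r\<close>, so the modulus of continuity applies to each increment.\<close>

lemma dif_avg_avg_small:
  assumes "\<And>f r x v. bdd 1 f \<Longrightarrow> r > 0 \<Longrightarrow> norm v \<le> \<eta> * r \<Longrightarrow>
       \<bar>avg r (avg (-r) f) (x + v) - avg r (avg (-r) f) x\<bar> \<le> e"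
    and f: "bdd 1 f" and "0 < s" "s \<le> \<eta> * r" "0 < r"
  shows "bdd e (dif s (avg r (avg (-r) f)))"
proof -
  let ?K = "avg r (avg (-r) f)"
  have K: "bdd 1 ?K" by (intro avg_bdd f)
  have "\<bar>dif s ?K x\<bar> \<le> e" for x
  proof -
    have "dif s ?K x = (\<integral>y. ?K (x + s *\<^sub>R y) - ?K x \<partial>\<mu>)"
      using bdd_integrable_mu[OF K] by (simp add: dif_def avg_def[of s] prob_space[simplified])
    also have "\<bar>\<dots>\<bar> \<le> (\<integral>y. \<bar>?K (x + s *\<^sub>R y) - ?K x\<bar> \<partial>\<mu>)"
      by (rule integral_abs_bound)
    also have "\<dots> \<le> e"
    proof (rule integral_le_const)
      show "integrable \<mu> (\<lambda>y. \<bar>?K (x + s *\<^sub>R y) - ?K x\<bar>)"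
        using bdd_integrable_mu[OF K] by simp
      show "AE y in \<mu>. \<bar>?K (x + s *\<^sub>R y) - ?K x\<bar> \<le> e"
        using AE_norm by eventually_elim (rule assms(1)[OF f], use assms in auto)
    qed
    finally show ?thesis .
  qed
  then show ?thesis using dif_bdd[OF K, of s] by (simp add: bdd_def)
qed

section \<open>Almost orthogonality and the number of bad scales\<close>

text \<open>With \<open>U = avg r \<circ> dif (-r)\<close>, that is \<open>avg r \<circ> avg (-r) - avg r\<close>, this is \<open>U\<^sup>* U\<close>.\<close>

definition sq :: "real \<Rightarrow> ('a \<Rightarrow> real) \<Rightarrow> 'a \<Rightarrow> real" where
  "sq r f = dif (-r) (dif r (avg r (avg (-r) f)))"

lemma sq_adm:
  assumes "adm 1 m f" shows "adm 4 (4 * m) (sq r f)"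
  using dif_adm[OF dif_adm[OF avg_adm[OF avg_adm[OF assms]]]] by (simp add: sq_def)

text \<open>Adjointness moves first \<open>avg r\<close> and then \<open>dif (-r)\<close> to the
  other factor; since all these operators commute, the two differences can be brought
  outermost.\<close>

lemma integral_avg_dif_square:
  assumes f: "adm C m f"
  shows "(\<integral>x. (avg r (dif (-r) f) x)\<^sup>2 \<partial>lborel) = (\<integral>x. f x * sq r f x \<partial>lborel)"
proof -
  let ?g = "dif (-r) f"
  have g: "adm (2 * C) (2 * m) ?g" by (rule dif_adm[OF f])
  have "(\<integral>x. (avg r ?g x)\<^sup>2 \<partial>lborel) = (\<integral>x. avg r ?g x * avg r ?g x \<partial>lborel)"
    by (simp add: power2_eq_square)
  also have "\<dots> = (\<integral>x. ?g x * avg (-r) (avg r ?g) x \<partial>lborel)"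
    by (rule avg_adjoint[OF g avg_adm[OF g]])
  also have "\<dots> = (\<integral>x. f x * dif r (avg (-r) (avg r ?g)) x \<partial>lborel)"
    using dif_adjoint[OF f avg_adm[OF avg_adm[OF g]], of "-r"] by simp
  also have "dif r (avg (-r) (avg r ?g)) = sq r f"
  proof -
    note b = adm_bdd[OF f]
    have "avg (-r) (avg r ?g) = dif (-r) (avg r (avg (-r) f))"
      using avg_dif_commute[OF b, of r "-r"] avg_dif_commute[OF avg_bdd[OF b], of "-r" "-r" r]
          avg_commute[OF b, of r "-r"] by simp
    then show ?thesis
      using dif_dif_commute[OF avg_bdd[OF avg_bdd[OF b]], of r "-r"] by (simp add: sq_def)
  qed
  finally show ?thesis .
qed

lemma integral_mult_le:
  assumes f: "adm C m f" and g: "bdd D g" and "0 \<le> D"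
  shows "(\<integral>x. f x * g x \<partial>lborel) \<le> m * D"
proof -
  have "(\<integral>x. f x * g x \<partial>lborel) \<le> (\<integral>x. \<bar>f x\<bar> * D \<partial>lborel)"
  proof (rule integral_mono)
    show "integrable lborel (\<lambda>x. f x * g x)"
      by (rule integrable_mult_bdd[OF adm_integrable[OF f] g])
    show "integrable lborel (\<lambda>x. \<bar>f x\<bar> * D)" using adm_integrable[OF f] by simp
    show "f x * g x \<le> \<bar>f x\<bar> * D" for x
      using abs_ge_self[of "f x * g x"] mult_left_mono[OF bdd_bound[OF g, of x], of "\<bar>f x\<bar>"]
      by (simp add: abs_mult)
  qed
  also have "\<dots> \<le> m * D" using adm_L1[OF f] \<open>0 \<le> D\<close> by (simp add: mult_right_mono)
  finally show ?thesis .
qed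

text \<open>The outer \<open>dif (-s)\<close> of \<open>sq s f\<close> crosses over as
  \<open>dif s\<close> and commutes inwards until it meets the double average at \<open>r\<close>,
  where the result is at most \<open>e\<close>. The two remaining differences cost a factor two
  each, and what is left of \<open>sq s f\<close> has \<open>L\<^sup>1\<close> norm at most
  \<open>2 * m\<close>.\<close>

lemma sq_almost_orthogonal:
  assumes f: "adm 1 m f" and "0 \<le> e" and small: "bdd e (dif s (avg r (avg (-r) f)))"
  shows "(\<integral>x. sq s f x * sq r f x \<partial>lborel) \<le> 8 * e * m"
proof -
  let ?h = "dif s (avg s (avg (-s) f))" and ?K = "avg r (avg (-r) f)"
  have K: "adm 1 m ?K" by (intro avg_adm f)
  have h: "adm 2 (2 * m) ?h" using dif_adm[OF avg_adm[OF avg_adm[OF f]]] by simp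
  have "(\<integral>x. sq s f x * sq r f x \<partial>lborel) = (\<integral>x. ?h x * dif s (sq r f) x \<partial>lborel)"
    using dif_adjoint[OF h sq_adm[OF f], of "-s" r] by (simp add: sq_def[of s])
  also have "dif s (sq r f) = dif (-r) (dif r (dif s ?K))"
    using dif_dif_commute[OF dif_bdd[OF adm_bdd[OF K]], of s "-r" r] dif_dif_commute[OF adm_bdd[OF
        K], of s r]
    by (simp add: sq_def)
  also have "(\<integral>x. ?h x * dif (-r) (dif r (dif s ?K)) x \<partial>lborel) \<le> (2 * m) * (2 * (2 * e))"
    by (rule integral_mult_le[OF h dif_bdd[OF dif_bdd[OF small]]]) (use assms in auto)
  finally show ?thesis by (simp add: algebra_simps)
qed

text \<open>A Bessel argument: each \<open>sq (r i) f\<close> pairs with \<open>f\<close> to at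
  least \<open>\<kappa> * m\<close>, so the pairing of \<open>f\<close> with their sum
  \<open>G\<close> grows linearly in their number, while almost orthogonality keeps the norm of
  \<open>G\<close> small. \<open>M\<close> and \<open>\<eta>\<close> depend on
  \<open>\<kappa>\<close> only, so the function may be chosen after them.\<close>

lemma bounded_bad_scales:
  fixes \<kappa> :: real
  assumes "\<kappa> > 0"
  obtains \<eta> :: real and M :: nat where "\<eta> > 0"
    "\<And>(I :: nat set) r f m. finite I \<Longrightarrow> adm 1 m f \<Longrightarrow> m > 0 \<Longrightarrow> (\<And>i. i \<in> I \<Longrightarrow> r i > 0) \<Longrightarrow>
       (\<And>i j. i \<in> I \<Longrightarrow> j \<in> I \<Longrightarrow> i < j \<Longrightarrow> r i \<le> \<eta> * r j) \<Longrightarrow>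
       (\<And>i. i \<in> I \<Longrightarrow> \<kappa> * m \<le> (\<integral>x. (avg (r i) (dif (- r i) f) x)\<^sup>2 \<partial>lborel)) \<Longrightarrow> card I \<le> M"
proof -
  \<comment> \<open>With this value the off-diagonal term \<open>n * (8 * e)\<close> is half of
    \<open>n * \<kappa>\<^sup>2\<close> and can be absorbed, which leaves the bound
    \<open>32 / \<kappa>\<^sup>2\<close>.\<close>
  define e where "e = \<kappa>\<^sup>2 / 16"
  have "e > 0" using assms by (simp add: e_def)
  then obtain \<eta> where eta: "\<eta> > 0" "\<And>f r x v. bdd 1 f \<Longrightarrow> r > 0 \<Longrightarrow> norm v \<le> \<eta> * r \<Longrightarrow>
       \<bar>avg r (avg (-r) f) (x + v) - avg r (avg (-r) f) x\<bar> \<le> e"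
    using avg_avg_equicontinuous by blast
  show ?thesis
  proof (rule that[of \<eta> "nat \<lceil>32 / \<kappa>\<^sup>2\<rceil>", OF eta(1)])
    fix I :: "nat set" and r :: "nat \<Rightarrow> real" and f :: "'a \<Rightarrow> real" and m :: real
    assume I: "finite I" and f: "adm 1 m f" and m: "m > 0" and r: "\<And>i. i \<in> I \<Longrightarrow> r i > 0"
      and lac: "\<And>i j. i \<in> I \<Longrightarrow> j \<in> I \<Longrightarrow> i < j \<Longrightarrow> r i \<le> \<eta> * r j"
      and bad: "\<And>i. i \<in> I \<Longrightarrow> \<kappa> * m \<le> (\<integral>x. (avg (r i) (dif (- r i) f) x)\<^sup>2 \<partial>lborel)"
    let ?S = "\<lambda>i. sq (r i) f"
    define n where "n = real (card I)"
    define G where "G = (\<lambda>x. \<Sum>i\<in>I. ?S i x)"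
    note S = sq_adm[OF f]
    have SS: "integrable lborel (\<lambda>x. ?S i x * ?S j x)" for i j
      by (rule integrable_mult_bdd[OF adm_integrable[OF S] adm_bdd[OF S]])
    have fS: "integrable lborel (\<lambda>x. f x * ?S i x)" for i
      by (rule integrable_mult_bdd[OF adm_integrable[OF f] adm_bdd[OF S]])
    have ff: "integrable lborel (\<lambda>x. f x * f x)"
      by (rule integrable_mult_bdd[OF adm_integrable[OF f] adm_bdd[OF f]])
    have diag: "(\<integral>x. ?S i x * ?S i x \<partial>lborel) \<le> 16 * m" for i
      using integral_mult_le[OF S adm_bdd[OF S], of "r i" "r i"] by simp
    \<comment> \<open>The shorter radius \<open>r i\<close> supplies the difference, the longer one
      \<open>r j\<close> the smooth double average.\<close>
    have offl: "(\<integral>x. ?S i x * ?S j x \<partial>lborel) \<le> 8 * e * m" if "i \<in> I" "j \<in> I" "i < j" for i j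
    proof (rule sq_almost_orthogonal[OF f])
      show "bdd e (dif (r i) (avg (r j) (avg (- r j) f)))"
        by (rule dif_avg_avg_small[OF eta(2) adm_bdd[OF f]]) (use that r lac in auto)
    qed (use \<open>e > 0\<close> in simp)
    have off: "(\<integral>x. ?S i x * ?S j x \<partial>lborel) \<le> 8 * e * m" if "i \<in> I" "j \<in> I" "i \<noteq> j" for i j
      using offl[of i j] offl[of j i] that by (cases "i < j") (auto simp: mult.commute)
    have G2: "(G x)\<^sup>2 = (\<Sum>i\<in>I. \<Sum>j\<in>I. ?S i x * ?S j x)" for x
      by (simp add: G_def power2_eq_square sum_product)
    have iG2: "integrable lborel (\<lambda>x. (G x)\<^sup>2)" unfolding G2 using SS by simp
    have "(\<integral>x. (G x)\<^sup>2 \<partial>lborel) = (\<Sum>i\<in>I. \<Sum>j\<in>I. \<integral>x. ?S i x * ?S j x \<partial>lborel)"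
      unfolding G2 using SS by simp
    also have "\<dots> \<le> (\<Sum>i\<in>I. \<Sum>j\<in>I. (if i = j then 16 * m else 0) + 8 * e * m)"
      using diag off m \<open>e > 0\<close> by (intro sum_mono) (auto intro: order_trans[OF diag])
    also have "\<dots> = n * (16 * m) + n * n * (8 * e * m)"
      using I by (simp add: sum.distrib n_def algebra_simps)
    finally have L2: "(\<integral>x. (G x)\<^sup>2 \<partial>lborel) \<le> n * (16 * m) + n * n * (8 * e * m)" .
    have fm: "(\<integral>x. f x * f x \<partial>lborel) \<le> m"
      using integral_mult_le[OF f adm_bdd[OF f]] by simp
    have ifG: "integrable lborel (\<lambda>x. f x * G x)" unfolding G_def sum_distrib_left using fS by simp
    have "n * (\<kappa> * m) = (\<Sum>i\<in>I. \<kappa> * m)" by (simp add: n_def)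
    also have "\<dots> \<le> (\<Sum>i\<in>I. \<integral>x. f x * ?S i x \<partial>lborel)"
      using bad integral_avg_dif_square[OF f] by (intro sum_mono) simp
    also have "\<dots> = (\<integral>x. f x * G x \<partial>lborel)"
      unfolding G_def sum_distrib_left using fS by simp
    finally have lower: "n * (\<kappa> * m) \<le> (\<integral>x. f x * G x \<partial>lborel)" .
    \<comment> \<open>The square of \<open>c * f - G\<close> is integrated;
      \<open>c = n * \<kappa>\<close>, inserted below, is optimal for the given lower bound.\<close>
    have upper: "2 * c * (\<integral>x. f x * G x \<partial>lborel) \<le> c\<^sup>2 * m + (n * (16 * m) + n * n * (8 * e * m))"
      for c
    proof -
      have "(\<integral>x. (2 * c) * (f x * G x) \<partial>lborel) \<le> (\<integral>x. c\<^sup>2 * (f x * f x) + (G x)\<^sup>2 \<partial>lborel)"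
      proof (rule integral_mono)
        show "2 * c * (f x * G x) \<le> c\<^sup>2 * (f x * f x) + (G x)\<^sup>2" for x
          using zero_le_power2[of "c * f x - G x"] by (simp add: power2_eq_square algebra_simps)
      qed (use ifG ff iG2 in auto)
      also have "\<dots> = c\<^sup>2 * (\<integral>x. f x * f x \<partial>lborel) + (\<integral>x. (G x)\<^sup>2 \<partial>lborel)"
        using ff iG2 by simp
      also have "\<dots> \<le> c\<^sup>2 * m + (n * (16 * m) + n * n * (8 * e * m))"
        using fm L2 by (intro add_mono mult_left_mono) auto
      finally show ?thesis by simp
    qed
    have "card I \<le> nat \<lceil>32 / \<kappa>\<^sup>2\<rceil>"
    proof (cases "n = 0")
      case False
      then have n: "n > 0" by (simp add: n_def)
      have "2 * (n * \<kappa>) * (n * (\<kappa> * m)) \<le> (n * \<kappa>)\<^sup>2 * m + (n * (16 * m) + n * n * (8 * e * m))"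
        by (rule order_trans[OF mult_left_mono[OF lower] upper]) (use n assms in simp)
      then have "(n * m) * (n * \<kappa>\<^sup>2) \<le> (n * m) * (16 + n * (8 * e))"
        by (simp add: power2_eq_square algebra_simps)
      then have "n * \<kappa>\<^sup>2 \<le> 16 + n * (8 * e)" using n m by simp
      then have "n \<le> 32 / \<kappa>\<^sup>2" using assms by (simp add: e_def field_simps)
      then show ?thesis unfolding n_def by linarith
    qed (simp add: n_def)
    then show "card I \<le> nat \<lceil>32 / \<kappa>\<^sup>2\<rceil>" .
  qed
qed

section \<open>Points without a neighbour in a large subset\<close>

lemma bdd_indicator: "B \<in> sets borel \<Longrightarrow> bdd 1 (indicat_real B)"
  by (auto simp: bdd_def split: split_indicator)

lemma adm_indicator:
  assumes "B \<in> sets borel" "emeasure lborel B < \<infinity>"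
  shows "adm 1 (measure lborel B) (indicat_real B)"
  using assms by (auto simp: adm_def bdd_indicator)

text \<open>By adjointness the integral is the squared norm of the average \<open>?g\<close> of the
  indicator of \<open>B\<close>. This average has integral \<open>measure lborel B\<close> and lives
  on \<open>Q\<close>, so Cauchy-Schwarz applies.\<close>

lemma lower_bound_avg_avg:
  assumes B: "B \<in> sets borel" and Q: "Q \<in> sets borel" "emeasure lborel Q < \<infinity>"
    and sub: "\<And>x y. x \<in> B \<Longrightarrow> norm y = \<bar>r\<bar> \<Longrightarrow> x + y \<in> Q" and BQ: "emeasure lborel B < \<infinity>"
  shows "(measure lborel B)\<^sup>2 \<le> measure lborel Q * (\<integral>x. indicat_real B x * avg r (avg (-r)
      (indicat_real B)) x \<partial>lborel)"
proof -
  let ?b = "indicat_real B" and ?q = "indicat_real Q"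
  let ?g = "avg (-r) ?b"
  have b: "adm 1 (measure lborel B) ?b" using adm_indicator B BQ by blast
  note g = avg_adm[OF b, of "-r"]
  have q: "adm 1 (measure lborel Q) ?q" using adm_indicator Q by blast
  have eq: "(\<integral>x. ?b x * avg r ?g x \<partial>lborel) = (\<integral>x. ?g x * ?g x \<partial>lborel)"
    using avg_adjoint[OF g b, of r] by (simp add: mult.commute)
  have supp: "?g x = ?g x * ?q x" for x
  proof (cases "x \<in> Q")
    case False
    have "AE y in \<mu>. ?b (x + (-r) *\<^sub>R y) = 0"
      using AE_norm
    proof eventually_elim
      case (elim y)
      show ?case
        using sub[of "x + (-r) *\<^sub>R y" "r *\<^sub>R y"] False elim by (auto split: split_indicator)
    qed
    then have "?g x = 0" unfolding avg_def by (rule integral_eq_zero_AE)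
    then show ?thesis by simp
  qed simp
  have igg: "integrable lborel (\<lambda>x. ?g x * ?g x)"
    by (rule integrable_mult_bdd[OF adm_integrable[OF g] adm_bdd[OF g]])
  have total: "(\<integral>x. ?g x * ?q x \<partial>lborel) = measure lborel B"
    using avg_integrable(2)[OF adm_integrable[OF b], of "-r"] B unfolding supp[symmetric] by simp
  have igq: "integrable lborel (\<lambda>x. ?g x * ?q x)"
    using adm_integrable[OF g] unfolding supp[symmetric] .
  have iq: "integrable lborel ?q" using adm_integrable[OF q] .
  \<comment> \<open>Cauchy-Schwarz in parametric form, from the square of \<open>?g x - c\<close> on
    \<open>Q\<close>; the optimal \<open>c = mB / mQ\<close> is inserted at the end, once
    \<open>mQ = 0\<close> has been treated.\<close>
  have key: "2 * c * measure lborel B \<le> (\<integral>x. ?g x * ?g x \<partial>lborel) + c\<^sup>2 * measure lborel Q" for c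
  proof -
    have "(\<integral>x. (2 * c) * (?g x * ?q x) \<partial>lborel) \<le> (\<integral>x. ?g x * ?g x + c\<^sup>2 * ?q x \<partial>lborel)"
    proof (rule integral_mono)
      show "2 * c * (?g x * ?q x) \<le> ?g x * ?g x + c\<^sup>2 * ?q x" for x
        using zero_le_power2[of "?g x - c"]
          by (auto simp: power2_eq_square algebra_simps split: split_indicator)
    qed (use igg igq iq in auto)
    also have "\<dots> = (\<integral>x. ?g x * ?g x \<partial>lborel) + c\<^sup>2 * measure lborel Q"
      using igg iq Q by simp
    finally show ?thesis using total by simp
  qed
  define P where "P = (\<integral>x. ?g x * ?g x \<partial>lborel)"
  define mB where "mB = measure lborel B"
  define mQ where "mQ = measure lborel Q"
  have k: "2 * c * mB \<le> P + c\<^sup>2 * mQ" for c using key unfolding P_def mB_def mQ_def .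
  have "mB\<^sup>2 \<le> mQ * P"
  proof (cases "mQ = 0")
    case True
    have "mB = 0"
    proof -
      have total0: "(\<integral>x. ?q x \<partial>lborel) = 0" using True Q by (simp add: mQ_def)
      have "mB \<le> (\<integral>x. ?q x \<partial>lborel)"
        unfolding mB_def total[symmetric]
        using igq iq bdd_bound[OF adm_bdd[OF g]]
        by (intro integral_mono) (auto split: split_indicator intro: order_trans[OF abs_ge_self])
      then show ?thesis using total0 by (simp add: mB_def) (metis antisym measure_nonneg)
    qed
    then show ?thesis using True by simp
  next
    case False
    then have pos: "mQ > 0" using measure_nonneg[of lborel Q] unfolding mQ_def by linarith
    have "2 * (mB / mQ) * mB \<le> P + (mB / mQ)\<^sup>2 * mQ" by (rule k)
    then show ?thesis using pos by (simp add: power2_eq_square field_simps)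
  qed
  then show ?thesis unfolding eq P_def mB_def mQ_def .
qed

text \<open>On \<open>B\<close> the average of the indicator of \<open>A\<close> sees only
  \<open>A - G\<close>. There the double average of the indicator of \<open>A\<close>, which
  dominates that of \<open>B\<close>, equals \<open>?U\<close> plus the average of
  \<open>A - G\<close>. Integration bounds these two terms by \<open>\<kappa>\<close> and
  \<open>\<tau>\<close> times the measure of \<open>A\<close>; \<open>lower_bound_avg_avg\<close>
  bounds the left side from below.\<close>

lemma bad_set_small:
  assumes A: "A \<in> sets borel" "emeasure lborel A < \<infinity>"
    and B: "B \<in> sets borel" "B \<subseteq> A" and G: "G \<in> sets borel" "G \<subseteq> A"
    and Q: "Q \<in> sets borel" "emeasure lborel Q < \<infinity>"
    and sub: "\<And>x y. x \<in> A \<Longrightarrow> norm y = \<bar>r\<bar> \<Longrightarrow> x + y \<in> Q"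
    and L: "measure lborel Q \<le> L * measure lborel A"
    and zero: "\<And>x. x \<in> B \<Longrightarrow> avg r (indicat_real G) x = 0"
    and energy: "(\<integral>x. (avg r (dif (-r) (indicat_real A)) x)\<^sup>2 \<partial>lborel) \<le> \<kappa>\<^sup>2 * measure lborel A"
    and GA: "measure lborel (A - G) \<le> \<tau> * measure lborel A" and "\<kappa> > 0" "L > 0"
  shows "(measure lborel B)\<^sup>2 \<le> L * (\<tau> + \<kappa>) * (measure lborel A)\<^sup>2"
proof -
  let ?a = "indicat_real A" and ?b = "indicat_real B" and ?g = "indicat_real G"
  define mA where "mA = measure lborel A"
  have finB: "emeasure lborel B < \<infinity>" using emeasure_mono[of B A lborel] B A
    by (metis infinity_ennreal_def order_le_less_trans sets_lborel)
  have finD: "emeasure lborel (A - G) < \<infinity>" using emeasure_mono[of "A - G" A lborel] G A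
    by (metis Diff_subset infinity_ennreal_def order_le_less_trans sets_lborel)
  have D: "A - G \<in> sets borel" using A G by auto
  have a: "adm 1 mA ?a" and b: "adm 1 (measure lborel B) ?b"
    and d: "adm 1 (measure lborel (A - G)) (indicat_real (A - G))"
    using adm_indicator A B finB D finD by (auto simp: mA_def)
  have mB: "measure lborel B \<le> mA"
    unfolding mA_def using A B by (intro measure_mono_fmeasurable) (auto simp: fmeasurable_def)
  let ?U = "avg r (dif (-r) ?a)"
  have U: "adm 2 (2 * mA) ?U" using avg_adm[OF dif_adm[OF a]] by simp
  have iUU: "integrable lborel (\<lambda>x. ?U x * ?U x)"
    by (rule integrable_mult_bdd[OF adm_integrable[OF U] adm_bdd[OF U]])
  have ibU: "integrable lborel (\<lambda>x. ?b x * ?U x)"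
    by (rule integrable_mult_bdd[OF adm_integrable[OF b] adm_bdd[OF U]])
  have ib: "integrable lborel ?b" using adm_integrable[OF b] .
  \<comment> \<open>Arithmetic-geometric mean inequality with weight \<open>\<kappa>\<close> in
    place of Cauchy-Schwarz: both resulting terms are at most
    \<open>\<kappa>\<^sup>2 * mA\<close>.\<close>
  have "2 * \<kappa> * (\<integral>x. ?b x * ?U x \<partial>lborel) = (\<integral>x. 2 * \<kappa> * (?b x * ?U x) \<partial>lborel)" by simp
  also have "\<dots> \<le> (\<integral>x. \<kappa>\<^sup>2 * ?b x + ?U x * ?U x \<partial>lborel)"
  proof (rule integral_mono)
    show "2 * \<kappa> * (?b x * ?U x) \<le> \<kappa>\<^sup>2 * ?b x + ?U x * ?U x" for x
      using zero_le_power2[of "?U x - \<kappa>"]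
        by (auto simp: power2_eq_square algebra_simps split: split_indicator)
  qed (use ib iUU ibU in auto)
  also have "\<dots> = \<kappa>\<^sup>2 * measure lborel B + (\<integral>x. (?U x)\<^sup>2 \<partial>lborel)"
    using ib iUU B by (simp add: power2_eq_square)
  also have "\<dots> \<le> \<kappa>\<^sup>2 * mA + \<kappa>\<^sup>2 * mA"
    using energy mB unfolding mA_def by (intro add_mono mult_left_mono) auto
  finally have "2 * \<kappa> * (\<integral>x. ?b x * ?U x \<partial>lborel) \<le> 2 * \<kappa> * (\<kappa> * mA)"
    by (simp add: power2_eq_square)
  then have e1: "(\<integral>x. ?b x * ?U x \<partial>lborel) \<le> \<kappa> * mA" using \<open>\<kappa> > 0\<close> by simp

  have Ueq: "?U x = avg r (avg (-r) ?a) x - avg r ?a x" for x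
    using avg_diff[OF avg_bdd[OF adm_bdd[OF a], of "-r"] adm_bdd[OF a], of r x]
      by (simp add: dif_def[abs_def])
  have "(measure lborel B)\<^sup>2 \<le> measure lborel Q * (\<integral>x. ?b x * avg r (avg (-r) ?b) x \<partial>lborel)"
    by (rule lower_bound_avg_avg) (use B Q sub finB in auto)
  \<comment> \<open>The second summand needs no factor \<open>?b\<close>: it is nonnegative, and its
    integral over the whole space is just the measure of \<open>A - G\<close>.\<close>
  also have "(\<integral>x. ?b x * avg r (avg (-r) ?b) x \<partial>lborel) \<le> (\<integral>x. ?b x * ?U x + avg r (indicat_real (A
      - G)) x \<partial>lborel)"
  proof (rule integral_mono)
    show "integrable lborel (\<lambda>x. ?b x * avg r (avg (-r) ?b) x)"
      by (rule integrable_mult_bdd[OF ib adm_bdd[OF avg_adm[OF avg_adm[OF b]]]])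
    show "integrable lborel (\<lambda>x. ?b x * ?U x + avg r (indicat_real (A - G)) x)"
      using ibU adm_integrable[OF avg_adm[OF d]] by simp
    show "?b x * avg r (avg (-r) ?b) x \<le> ?b x * ?U x + avg r (indicat_real (A - G)) x" for x
    proof (cases "x \<in> B")
      case True
      have "avg r (avg (-r) ?b) x \<le> avg r (avg (-r) ?a) x"
      proof (rule avg_mono[OF avg_bdd avg_bdd])
        show "avg (-r) ?b y \<le> avg (-r) ?a y" for y
          by (rule avg_mono[OF adm_bdd[OF b] adm_bdd[OF a]]) (use B in \<open>auto split:
              split_indicator\<close>)
      qed (rule adm_bdd[OF b] adm_bdd[OF a])+
      moreover have "avg r ?a x = avg r (indicat_real (A - G)) x"
      proof -
        have "(\<lambda>x. ?a x - ?g x) = indicat_real (A - G)"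
          using G by (auto simp: fun_eq_iff split: split_indicator)
        with avg_diff[OF adm_bdd[OF a] bdd_indicator[OF G(1)], of r x] zero[OF True] show ?thesis
          by simp
      qed
      ultimately show ?thesis using True by (simp add: Ueq)
    next
      case False
      have "0 \<le> avg r (indicat_real (A - G)) x" by (simp add: avg_def)
      then show ?thesis using False by simp
    qed
  qed
  also have "(\<integral>x. ?b x * ?U x + avg r (indicat_real (A - G)) x \<partial>lborel) =
      (\<integral>x. ?b x * ?U x \<partial>lborel) + measure lborel (A - G)"
    using ibU adm_integrable[OF avg_adm[OF d]] avg_integrable(2)[OF adm_integrable[OF d]] D by simp
  also have "\<dots> \<le> (\<tau> + \<kappa>) * mA" using e1 GA by (simp add: algebra_simps mA_def)
  finally have 1: "(measure lborel B)\<^sup>2 \<le> measure lborel Q * ((\<tau> + \<kappa>) * mA)"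
    by (simp add: mult_left_mono)
  have "0 \<le> \<tau> * mA" using GA measure_nonneg[of lborel "A - G"] unfolding mA_def by linarith
  then have "0 \<le> (\<tau> + \<kappa>) * mA" using \<open>\<kappa> > 0\<close> by (simp add: distrib_right mA_def)
  from 1 mult_right_mono[OF L this] show ?thesis
    unfolding mA_def by (simp add: power2_eq_square algebra_simps)
qed

end

section \<open>The arc measure in the plane\<close>

text \<open>The inverse of an expanding map is Lipschitz, and Lipschitz maps send null sets to null
  sets.\<close>

lemma negligible_if_expanding_image:
  fixes \<psi> :: "real \<Rightarrow> real"
  assumes "c > 0" and exp: "\<And>u v. u \<in> S \<Longrightarrow> v \<in> S \<Longrightarrow> c * \<bar>u - v\<bar> \<le> \<bar>\<psi> u - \<psi> v\<bar>"
    and neg: "negligible (\<psi> ` S)"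
  shows "negligible S"
proof -
  have inj: "inj_on \<psi> S"
    using exp \<open>c > 0\<close> by (force intro!: inj_onI simp: mult_le_0_iff)
  have "negligible (inv_into S \<psi> ` (\<psi> ` S))"
  proof (rule negligible_locally_Lipschitz_image[OF _ neg])
    fix x assume x: "x \<in> \<psi> ` S"
    have "norm (inv_into S \<psi> y - inv_into S \<psi> x) \<le> inverse c * norm (y - x)" if "y \<in> \<psi> ` S" for y
      using exp[OF inv_into_into[OF that] inv_into_into[OF x]] f_inv_into_f[OF that] f_inv_into_f[OF
          x] \<open>c > 0\<close>
      by (simp add: field_simps)
    then show "\<exists>T B. open T \<and> x \<in> T \<and> (\<forall>y\<in>\<psi> ` S \<inter> T. norm (inv_into S \<psi> y - inv_into S \<psi> x) \<le>
        B * norm (y - x))"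
      by (intro exI[of _ UNIV] exI[of _ "inverse c"]) auto
  qed simp
  also have "inv_into S \<psi> ` (\<psi> ` S) = S" using inj by (simp add: inv_into_image_cancel)
  finally show ?thesis .
qed

text \<open>\<open>s / sqrt (1 - s\<^sup>2)\<close> is minus the slope of the upper unit circle. Its
  derivative is at least one, so it is still nondecreasing after subtracting \<open>s\<close>; the
  bound 1/2 keeps away from the vertical tangents.\<close>

lemma circle_slope_expanding:
  fixes a b :: real
  assumes "\<bar>a\<bar> \<le> 1/2" "\<bar>b\<bar> \<le> 1/2" "a \<le> b"
  shows "b - a \<le> b / sqrt (1 - b\<^sup>2) - a / sqrt (1 - a\<^sup>2)"
proof -
  have "a / sqrt (1 - a\<^sup>2) - a \<le> b / sqrt (1 - b\<^sup>2) - b"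
  proof (rule DERIV_nonneg_imp_nondecreasing[OF \<open>a \<le> b\<close>])
    fix s assume s: "a \<le> s" "s \<le> b"
    then have "\<bar>s\<bar> \<le> 1/2" using assms by auto
    then have "s\<^sup>2 \<le> (1/2)\<^sup>2" by (metis abs_ge_zero power2_abs power_mono)
    then have s2: "1 - s\<^sup>2 > 0" by (simp add: power2_eq_square)
    let ?w = "sqrt (1 - s\<^sup>2)"
    have w: "?w > 0" "?w \<le> 1" "?w\<^sup>2 = 1 - s\<^sup>2" using s2 by auto
    have d: "((\<lambda>s. s / sqrt (1 - s\<^sup>2) - s) has_real_derivative
       ((1 * ?w - s * ((- (2 * s)) / (2 * ?w))) / (?w * ?w) - 1)) (at s)"
      by (rule derivative_eq_intros refl | use s2 in \<open>simp add: divide_simps\<close>)+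
    have "1 \<le> (1 * ?w - s * ((- (2 * s)) / (2 * ?w))) / (?w * ?w)"
    proof -
      have "?w * ?w \<le> ?w" using mult_left_mono[OF w(2) less_imp_le[OF w(1)]]
        by (simp only: mult_1_right)
      also have "?w \<le> ?w + s * s / ?w" using w by simp
      finally show ?thesis using w by (simp add: divide_simps mult.commute)
    qed
    then show "\<exists>y. ((\<lambda>s. s / sqrt (1 - s\<^sup>2) - s) has_real_derivative y) (at s) \<and> 0 \<le> y"
      using d by (intro exI conjI) auto
  qed
  then show ?thesis by simp
qed

text \<open>\<open>\<psi> u\<close> is the height difference between the points of the circle over
  \<open>p + u\<close> and \<open>u\<close>. By the mean value theorem its increments are governed
  by a difference of slopes at abscissae \<open>p\<close> apart, to which
  \<open>circle_slope_expanding\<close> applies.\<close>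

lemma circle_chord_expanding:
  fixes p u v :: real
  assumes "\<bar>u\<bar> \<le> 1/2" "\<bar>v\<bar> \<le> 1/2" "\<bar>p + u\<bar> \<le> 1/2" "\<bar>p + v\<bar> \<le> 1/2"
  defines "\<psi> \<equiv> \<lambda>u. sqrt (1 - (p + u)\<^sup>2) - sqrt (1 - u\<^sup>2)"
  shows "\<bar>p\<bar> * \<bar>u - v\<bar> \<le> \<bar>\<psi> u - \<psi> v\<bar>"
proof -
  have main: "\<bar>p\<bar> * \<bar>u - v\<bar> \<le> \<bar>\<psi> u - \<psi> v\<bar>"
    if "v < u" "\<bar>u\<bar> \<le> 1/2" "\<bar>v\<bar> \<le> 1/2" "\<bar>p + u\<bar> \<le> 1/2" "\<bar>p + v\<bar> \<le> 1/2" for u v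
  proof -
    have pos: "1 - s\<^sup>2 > 0" if "\<bar>s\<bar> \<le> 1/2" for s :: real
    proof -
      have "s\<^sup>2 \<le> (1/2)\<^sup>2" using that by (metis abs_ge_zero power2_abs power_mono)
      then show ?thesis by (simp add: power2_eq_square)
    qed
    let ?h = "\<lambda>s::real. s / sqrt (1 - s\<^sup>2)"
    have "\<exists>z. v < z \<and> z < u \<and> \<psi> u - \<psi> v = (u - v) * (?h z - ?h (p + z))"
    proof (rule MVT2[OF \<open>v < u\<close>])
      fix x assume x: "v \<le> x" "x \<le> u"
      then have "\<bar>x\<bar> \<le> 1/2" "\<bar>p + x\<bar> \<le> 1/2" using that unfolding abs_le_iff by linarith+
      from pos[OF this(1)] pos[OF this(2)]
      show "(\<psi> has_real_derivative ?h x - ?h (p + x)) (at x)"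
        unfolding \<psi>_def by (auto intro!: derivative_eq_intros simp: divide_simps) (simp add:
            algebra_simps)
    qed
    then obtain z where z: "v < z" "z < u" "\<psi> u - \<psi> v = (u - v) * (?h z - ?h (p + z))" by blast
    have "\<bar>z\<bar> \<le> 1/2" "\<bar>p + z\<bar> \<le> 1/2" using that z(1,2) unfolding abs_le_iff by linarith+
    then have "\<bar>p\<bar> \<le> \<bar>?h z - ?h (p + z)\<bar>"
      using circle_slope_expanding[of z "p + z"] circle_slope_expanding[of "p + z" z]
        by (cases "p \<ge> 0") auto
    then have "\<bar>u - v\<bar> * \<bar>p\<bar> \<le> \<bar>u - v\<bar> * \<bar>?h z - ?h (p + z)\<bar>" by (intro mult_left_mono) auto
    then show ?thesis unfolding z(3) abs_mult by (simp add: mult.commute)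
  qed
  consider "v < u" | "u < v" | "u = v" by linarith
  then show ?thesis
    using main[of v u] main[of u v] assms(1-4) by cases (auto simp: abs_minus_commute)
qed

section \<open>Coordinates and slices in the plane\<close>

definition pt :: "real \<Rightarrow> real \<Rightarrow> real ^ 2" where
  "pt p q = p *\<^sub>R axis 1 1 + q *\<^sub>R axis 2 1"

lemma pt_nth [simp]: "pt p q $ 1 = p" "pt p q $ 2 = q"
  by (simp_all add: pt_def axis_def)

lemma pt_diff: "pt p q - pt p' q' = pt (p - p') (q - q')"
  by (simp add: pt_def algebra_simps)

lemma norm_pt: "norm (pt p q) = sqrt (p\<^sup>2 + q\<^sup>2)"
  by (simp add: norm_vec_def L2_set_def sum_2)

lemma measurable_pt [measurable]:
  assumes [measurable]: "f \<in> borel_measurable M" "g \<in> borel_measurable M"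
  shows "(\<lambda>x. pt (f x) (g x)) \<in> borel_measurable M"
  unfolding pt_def by measurable

text \<open>Lebesgue measure is determined by its values on boxes, and the preimage of a box under
  \<open>pt\<close> is a product of two intervals.\<close>

lemma lborel_vec2: "(lborel :: (real ^ 2) measure) = distr (lborel \<Otimes>\<^sub>M lborel) borel (\<lambda>(p, q). pt p
    q)"
proof (rule lborel_eqI)
  fix l u :: "real ^ 2"
  assume le: "\<And>b. b \<in> Basis \<Longrightarrow> l \<bullet> b \<le> u \<bullet> b"
  have le': "l $ i \<le> u $ i" for i using le[of "axis i 1"]
    by (simp add: inner_axis axis_in_Basis_iff)
  have "(\<Prod>b\<in>Basis. (u - l) \<bullet> b) = measure lborel (cbox l u)"
    using le by (subst content_cbox) (auto simp: inner_diff_left)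
  also have "\<dots> = (\<Prod>i\<in>UNIV. u $ i - l $ i)"
    using le' by (intro content_cbox_cart) (auto simp: interval_ne_empty_cart)
  also have "\<dots> = (u $ 1 - l $ 1) * (u $ 2 - l $ 2)"
    by (simp add: UNIV_2)
  finally have prod: "(\<Prod>b\<in>Basis. (u - l) \<bullet> b) = (u $ 1 - l $ 1) * (u $ 2 - l $ 2)" .
  have "emeasure (distr (lborel \<Otimes>\<^sub>M lborel) borel (\<lambda>(p, q). pt p q)) (box l u) =
     emeasure (lborel \<Otimes>\<^sub>M lborel) ((\<lambda>(p, q). pt p q) -` box l u \<inter> space (lborel \<Otimes>\<^sub>M lborel))"
    by (rule emeasure_distr) auto
  also have "(\<lambda>(p, q). pt p q) -` box l u \<inter> space (lborel \<Otimes>\<^sub>M lborel) =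
      {l $ 1<..<u $ 1} \<times> {l $ 2<..<u $ 2}"
    by (auto simp: mem_box_cart forall_2 space_pair_measure)
  also have "emeasure (lborel \<Otimes>\<^sub>M lborel) \<dots> = emeasure lborel {l $ 1<..<u $ 1} * emeasure lborel {l
      $ 2<..<u $ 2}"
    by (rule lborel.emeasure_pair_measure_Times) auto
  also have "\<dots> = ennreal ((u $ 1 - l $ 1) * (u $ 2 - l $ 2))"
    using le' by (simp add: ennreal_mult)
  finally show "emeasure (distr (lborel \<Otimes>\<^sub>M lborel) borel (\<lambda>(p, q). pt p q)) (box l u) =
      ennreal (\<Prod>b\<in>Basis. (u - l) \<bullet> b)"
    unfolding prod .
qed simp

text \<open>By Tonelli the measure of \<open>Z\<close> is the integral of the lengths of its
  slices.\<close>

lemma null_set_vec2_slices: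
  assumes "Z \<in> null_sets (lborel :: (real ^ 2) measure)"
  shows "AE p in lborel. negligible {q. pt p q \<in> Z}"
proof -
  have Z [measurable]: "Z \<in> sets borel" using assms by auto
  have "0 = emeasure (lborel :: (real ^ 2) measure) Z" using assms by auto
  also have "\<dots> = (\<integral>\<^sup>+x. indicator Z x \<partial>(lborel :: (real ^ 2) measure))" by simp
  also have "\<dots> = (\<integral>\<^sup>+z. indicator Z (case z of (p, q) \<Rightarrow> pt p q) \<partial>(lborel \<Otimes>\<^sub>M lborel))"
    by (subst lborel_vec2, subst nn_integral_distr) auto
  also have "\<dots> = (\<integral>\<^sup>+p. \<integral>\<^sup>+q. indicator Z (pt p q) \<partial>lborel \<partial>lborel)"
    by (subst lborel.nn_integral_fst[symmetric]) (auto simp: case_prod_beta')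
  finally have "AE p in lborel. (\<integral>\<^sup>+q. indicator Z (pt p q) \<partial>lborel) = 0"
    by (subst (asm) eq_commute, subst (asm) nn_integral_0_iff_AE) auto
  then show ?thesis
  proof eventually_elim
    case (elim p)
    have m: "{q. pt p q \<in> Z} \<in> sets borel" by measurable
    have "(\<integral>\<^sup>+q. indicator Z (pt p q) \<partial>lborel) = (\<integral>\<^sup>+q. indicator {q. pt p q \<in> Z} q \<partial>lborel)"
      by (simp add: indicator_def)
    also have "\<dots> = emeasure lborel {q. pt p q \<in> Z}" using m by simp
    finally show ?case using elim m by (simp add: negligible_iff_null_sets null_sets_def)
  qed
qed

text \<open>An arc parametrised by its abscissa is used instead of the whole circle: then \<open>arc t - arc u\<close>
  has first coordinate \<open>t - u\<close>, so absolute continuity of the difference law is a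
  one-dimensional matter on each slice.\<close>

definition arc :: "real \<Rightarrow> real ^ 2" where "arc t = pt t (sqrt (1 - t\<^sup>2))"

text \<open>Uniform in the abscissa, not in arc length. The interval has length one, so no
  normalising factor appears, and it stays clear of the points where the slope blows up.\<close>

definition arc_measure :: "(real ^ 2) measure" where
  "arc_measure = distr (density lborel (indicator {-1/2..1/2})) borel arc"

lemma measurable_arc [measurable]: "arc \<in> borel_measurable borel"
  unfolding arc_def by measurable

lemma nn_integral_arc_measure:
  assumes [measurable]: "f \<in> borel_measurable borel"
  shows "(\<integral>\<^sup>+y. f y \<partial>arc_measure) = (\<integral>\<^sup>+t. indicator {-1/2..1/2} t * f (arc t) \<partial>lborel)"
  unfolding arc_measure_def by (subst nn_integral_distr) (auto simp: nn_integral_density)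

lemma sets_arc_measure [measurable_cong, simp]: "sets arc_measure = sets borel"
  by (simp add: arc_measure_def)

lemma prob_space_arc_measure: "prob_space arc_measure"
  unfolding arc_measure_def
proof (rule prob_space.prob_space_distr)
  show "prob_space (density lborel (indicator {-1/2..1/2::real}))"
    by (rule prob_spaceI) (simp add: emeasure_density)
qed simp

text \<open>The essential point is the difference law. In terms of \<open>p = t - u\<close>, a null
  set \<open>Z\<close> pulls back, for almost every \<open>p\<close>, to the preimage of a null
  slice under a map expanding by \<open>\<bar>p\<bar>\<close>, hence to a null set of
  \<open>u\<close>.\<close>

interpretation arc: sphere_measure arc_measure
proof (rule sphere_measure.intro)
  interpret prob_space arc_measure by (rule prob_space_arc_measure)
  interpret PP: pair_sigma_finite arc_measure arc_measure ..
  show "prob_space arc_measure" by (rule prob_space_arc_measure)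
  show "AE y in arc_measure. norm y = 1"
    unfolding arc_measure_def
  proof (subst AE_distr_iff)
    show "AE t in density lborel (indicator {-1/2..1/2}). norm (arc t) = 1"
    proof (subst AE_density, simp, rule AE_I2, rule impI)
      fix t :: real assume "0 < (indicator {-1/2..1/2} t :: ennreal)"
      then have "\<bar>t\<bar> \<le> 1" by (auto split: split_indicator_asm)
      then have "t\<^sup>2 \<le> 1" by (simp add: abs_square_le_1)
      then show "norm (arc t) = 1" by (simp add: arc_def norm_pt)
    qed
  qed auto
  show "absolutely_continuous lborel (distr (arc_measure \<Otimes>\<^sub>M arc_measure) borel (\<lambda>(y, z). y - z))"
    unfolding absolutely_continuous_def
  proof
    fix Z :: "(real ^ 2) set" assume Z0: "Z \<in> null_sets lborel"
    then have Z [measurable]: "Z \<in> sets borel" by auto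
    let ?i = "indicator {-1/2..1/2} :: real \<Rightarrow> ennreal"
    let ?\<psi> = "\<lambda>p u. sqrt (1 - (p + u)\<^sup>2) - sqrt (1 - u\<^sup>2)"
    have "emeasure (distr (arc_measure \<Otimes>\<^sub>M arc_measure) borel (\<lambda>(y, z). y - z)) Z =
      (\<integral>\<^sup>+w. indicator Z w \<partial>distr (arc_measure \<Otimes>\<^sub>M arc_measure) borel (\<lambda>(y, z). y - z))"
      by simp
    also have "\<dots> = (\<integral>\<^sup>+w. indicator Z (case w of (y, z) \<Rightarrow> y - z) \<partial>(arc_measure \<Otimes>\<^sub>M arc_measure))"
      by (subst nn_integral_distr) auto
    also have "\<dots> = (\<integral>\<^sup>+z. \<integral>\<^sup>+y. indicator Z (y - z) \<partial>arc_measure \<partial>arc_measure)"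
      by (subst PP.nn_integral_snd[symmetric]) (auto simp: case_prod_beta')
    also have "\<dots> = (\<integral>\<^sup>+u. ?i u * (\<integral>\<^sup>+t. ?i t * indicator Z (arc t - arc u) \<partial>lborel) \<partial>lborel)"
      by (simp add: nn_integral_arc_measure)
    also have "\<dots> = (\<integral>\<^sup>+u. \<integral>\<^sup>+t. ?i u * (?i t * indicator Z (arc t - arc u)) \<partial>lborel \<partial>lborel)"
      by (intro nn_integral_cong nn_integral_cmult[symmetric]) measurable
    \<comment> \<open>Writing \<open>t = p + u\<close> makes \<open>p\<close> the first coordinate
      of \<open>arc t - arc u\<close>, so that the order of integration can be exchanged to work on
      slices.\<close>
    also have "\<dots> = (\<integral>\<^sup>+u. \<integral>\<^sup>+p. ?i u * (?i (p + u) * indicator Z (arc (p + u) - arc u)) \<partial>lborel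
        \<partial>lborel)"
      by (intro nn_integral_cong nn_integral_lborel_shift[symmetric]) measurable
    also have "\<dots> = (\<integral>\<^sup>+p. \<integral>\<^sup>+u. ?i u * (?i (p + u) * indicator Z (arc (p + u) - arc u)) \<partial>lborel
        \<partial>lborel)"
      by (rule lborel_pair.Fubini') measurable
    also have "\<dots> = (\<integral>\<^sup>+p. 0 \<partial>(lborel :: real measure))"
    proof (rule nn_integral_cong_AE)
      show "AE p in lborel. (\<integral>\<^sup>+u. ?i u * (?i (p + u) * indicator Z (arc (p + u) - arc u)) \<partial>lborel)
          = 0"
        using null_set_vec2_slices[OF Z0] AE_lborel_singleton[of 0]
      proof eventually_elim
        case (elim p)
        define S where "S = {u. u \<in> {-1/2..1/2} \<and> p + u \<in> {-1/2..1/2} \<and> pt p (?\<psi> p u) \<in> Z}"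
        have S [measurable]: "S \<in> sets borel" unfolding S_def by measurable
        have "negligible S"
        proof (rule negligible_if_expanding_image)
          \<comment> \<open>The value \<open>p = 0\<close>, where the expansion constant vanishes,
            was discarded as a null set.\<close>
          show "\<bar>p\<bar> > 0" using elim by simp
          show "\<bar>p\<bar> * \<bar>u - v\<bar> \<le> \<bar>?\<psi> p u - ?\<psi> p v\<bar>" if "u \<in> S" "v \<in> S" for u v
            using that unfolding S_def mem_Collect_eq atLeastAtMost_iff
            by (intro circle_chord_expanding; unfold abs_le_iff; linarith)
          show "negligible (?\<psi> p ` S)"
            by (rule negligible_subset[OF elim(1)]) (auto simp: S_def)
        qed
        then have "emeasure lborel S = 0" by (simp add: negligible_iff_null_sets null_sets_def S)
        moreover have "?i u * (?i (p + u) * indicator Z (arc (p + u) - arc u)) = indicator S u"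
          for u
          by (auto simp: S_def arc_def pt_diff split: split_indicator)
        ultimately show ?case by simp
      qed
    qed
    finally show "Z \<in> null_sets (distr (arc_measure \<Otimes>\<^sub>M arc_measure) borel (\<lambda>(y, z). y - z))"
      by (simp add: null_sets_def)
  qed
qed simp

section \<open>Trees and their embeddings\<close>

text \<open>Trees in an order in which every new vertex is a leaf, which is the induction that the
  embedding needs.\<close>

inductive grown_tree :: "'v set \<Rightarrow> 'v set set \<Rightarrow> bool" where
  single: "grown_tree {v} {}"
| leaf: "grown_tree V E \<Longrightarrow> u \<in> V \<Longrightarrow> w \<notin> V \<Longrightarrow> grown_tree (insert w V) (insert {u, w} E)"

lemma grown_tree_finite: "grown_tree V E \<Longrightarrow> finite V"
  by (induction rule: grown_tree.induct) auto

lemma grown_tree_edges: "grown_tree V E \<Longrightarrow> e \<in> E \<Longrightarrow> e \<subseteq> V"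
  by (induction rule: grown_tree.induct) auto

lemma graph_walk_mono: "graph_walk V E p \<Longrightarrow> V \<subseteq> V' \<Longrightarrow> E \<subseteq> E' \<Longrightarrow> graph_walk V' E' p"
  unfolding graph_walk_def by (auto elim: successively_mono)

lemma graph_walk_rev: "graph_walk V E p \<Longrightarrow> graph_walk V E (rev p)"
  unfolding graph_walk_def by (auto simp: insert_commute)

text \<open>Distinctness is carried along so that an extra edge between the ends would close the
  walk to a cycle. A path to the new leaf is a path to its neighbour, extended by one
  vertex.\<close>

lemma grown_tree_path:
  assumes "grown_tree V E" "u \<in> V" "v \<in> V"
  shows "\<exists>p. graph_walk V E p \<and> distinct p \<and> hd p = u \<and> last p = v"
  using assms
proof (induction arbitrary: u v rule: grown_tree.induct)
  case (single x)
  then show ?case by (intro exI[of _ "[x]"]) (auto simp: graph_walk_def)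
next
  case (leaf V E x w)
  let ?V = "insert w V" and ?E = "insert {x, w} E"
  have to_w: "\<exists>p. graph_walk ?V ?E p \<and> distinct p \<and> hd p = a \<and> last p = w" if a: "a \<in> V" for a
  proof -
    obtain p where p: "graph_walk V E p" "distinct p" "hd p = a" "last p = x"
      using leaf.IH[OF a leaf.hyps(2)] by blast
    have "graph_walk ?V ?E p" using graph_walk_mono[OF p(1)] by blast
    then have "graph_walk ?V ?E (p @ [w])"
      using p(4) by (auto simp: graph_walk_def successively_append_iff)
    moreover have "distinct (p @ [w])" using p(1,2) leaf.hyps(3) by (auto simp: graph_walk_def)
    moreover have "hd (p @ [w]) = a" using p by (auto simp: graph_walk_def)
    ultimately show ?thesis by (intro exI[of _ "p @ [w]"]) auto
  qed
  consider "u \<in> V" "v \<in> V" | "u \<in> V" "v = w" | "u = w" "v \<in> V" | "u = w" "v = w"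
    using leaf.prems by blast
  then show ?case
  proof cases
    case 1
    then obtain p where p: "graph_walk V E p" "distinct p" "hd p = u" "last p = v"
      using leaf.IH by blast
    then show ?thesis using graph_walk_mono[OF p(1), of ?V ?E] by blast
  next
    case 2
    then show ?thesis using to_w by blast
  next
    case 3
    then obtain p where p: "graph_walk ?V ?E p" "distinct p" "hd p = v" "last p = w"
      using to_w by blast
    then show ?thesis
      using 3 graph_walk_rev[OF p(1)] by (intro exI[of _ "rev p"]) (auto simp: hd_rev last_rev)
  next
    case 4
    then show ?thesis by (intro exI[of _ "[w]"]) (auto simp: graph_walk_def)
  qed
qed

lemma successively_crossing:
  assumes "successively P p" "p \<noteq> []" "hd p \<in> S" "last p \<notin> S"
  shows "\<exists>x y. P x y \<and> x \<in> S \<and> y \<notin> S"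
  using assms
proof (induction p)
  case (Cons a p)
  show ?case
  proof (cases "p = []")
    case False
    then show ?thesis
      using Cons by (cases "hd p \<in> S") (auto simp: successively_Cons)
  qed (use Cons in auto)
qed simp

text \<open>Connectedness lets a subtree grow along an edge leaving its vertex set until it spans
  \<open>V\<close>. An edge missing from the spanning subtree would close one of its paths to a
  cycle.\<close>

lemma finite_tree_imp_grown_tree:
  assumes "finite_tree V E"
  shows "grown_tree V E"
proof -
  have finV: "finite V" and edges: "\<And>e. e \<in> E \<Longrightarrow> e \<subseteq> V \<and> card e = 2"
    and conn: "graph_connected V E" and acyc: "\<nexists>p. graph_cycle V E p"
    using assms by (auto simp: finite_tree_def finite_simple_graph_def)
  have "\<exists>V' E'. grown_tree V' E' \<and> V' \<subseteq> V \<and> E' \<subseteq> E \<and> card V' = Suc k" if "Suc k \<le> card V" for k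
    using that
  proof (induction k)
    case 0
    obtain v where "v \<in> V" using conn by (auto simp: graph_connected_def)
    then show ?case by (intro exI[of _ "{v}"] exI[of _ "{}"]) (auto intro: grown_tree.single)
  next
    case (Suc k)
    then obtain V' E' where IH: "grown_tree V' E'" "V' \<subseteq> V" "E' \<subseteq> E" "card V' = Suc k" by auto
    have "V' \<noteq> V" using IH Suc.prems by auto
    then obtain v u where vu: "v \<in> V" "v \<notin> V'" "u \<in> V'" using IH(2,4) by fastforce
    then obtain p where p: "graph_walk V E p" "hd p = u" "last p = v"
      using conn IH(2) unfolding graph_connected_def by blast
    then obtain x y where xy: "{x, y} \<in> E" "x \<in> V'" "y \<notin> V'"
      using successively_crossing[of "\<lambda>u v. {u, v} \<in> E" p V'] vu by (auto simp: graph_walk_def)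
    have "y \<in> V" using xy(1) edges by blast
    moreover have "card (insert y V') = Suc (Suc k)"
      using xy(3) IH(4) finite_subset[OF IH(2) finV] by simp
    ultimately show ?case
      using grown_tree.leaf[OF IH(1) xy(2,3)] IH(2,3) xy(1)
      by (intro exI[of _ "insert y V'"] exI[of _ "insert {x, y} E'"]) auto
  qed
  moreover have "card V \<noteq> 0" using finV conn by (auto simp: graph_connected_def)
  ultimately obtain V' E' where T: "grown_tree V' E'" "V' \<subseteq> V" "E' \<subseteq> E" "card V' = card V"
    by (metis Suc_pred neq0_conv order_refl)
  then have "V' = V" using finV card_subset_eq by blast
  have "E \<subseteq> E'"
  proof
    fix e assume e: "e \<in> E"
    show "e \<in> E'"
    proof (rule ccontr)
      assume ne: "e \<notin> E'"
      obtain u v where uv: "e = {u, v}" "u \<noteq> v" using edges[OF e] by (auto simp: card_2_iff)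
      have "u \<in> V'" "v \<in> V'" using edges[OF e] uv \<open>V' = V\<close> by auto
      then obtain p where p: "graph_walk V' E' p" "distinct p" "hd p = u" "last p = v"
        using grown_tree_path[OF T(1)] by blast
      \<comment> \<open>A single vertex is excluded by \<open>u \<noteq> v\<close>, two vertices by
        \<open>e \<notin> E'\<close>.\<close>
      have "length p \<ge> 3"
      proof (rule ccontr)
        assume "\<not> length p \<ge> 3"
        then consider "length p = 0" | "length p = 1" | "length p = 2" by linarith
        then show False
        proof cases
          case 1 then show False using p by (auto simp: graph_walk_def)
        next
          case 2 then show False using p uv by (auto simp: length_Suc_conv)
        next
          case 3
          then obtain a b where "p = [a, b]" by (auto simp: length_Suc_conv numeral_2_eq_2)
          then show False using p uv ne by (auto simp: graph_walk_def)
        qed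
      qed
      moreover have "graph_walk V E p" using graph_walk_mono[OF p(1) T(2,3)] .
      ultimately have "graph_cycle V E p"
        using p e uv by (auto simp: graph_cycle_def insert_commute)
      then show False using acyc by blast
    qed
  qed
  then show ?thesis using T \<open>V' = V\<close> by auto
qed

section \<open>Greedy embedding of a tree\<close>

context sphere_measure begin

text \<open>An atom at \<open>c\<close> would give the difference law an atom at zero, against
  absolute continuity. This is what keeps embeddings injective.\<close>

lemma AE_not_eq: "AE y in \<mu>. y \<noteq> c"
proof -
  let ?N = "distr (\<mu> \<Otimes>\<^sub>M \<mu>) borel (\<lambda>(y, z). y - z)"
  have "{0::'a} \<in> null_sets lborel" by auto
  then have "{0} \<in> null_sets ?N" using ac by (auto simp: absolutely_continuous_def)
  then have "emeasure ?N {0} = 0" by auto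
  then have z: "emeasure (\<mu> \<Otimes>\<^sub>M \<mu>) ((\<lambda>(y, z). y - z) -` {0} \<inter> space (\<mu> \<Otimes>\<^sub>M \<mu>)) = 0"
    by (subst (asm) emeasure_distr) auto
  have m: "(\<lambda>(y, z). y - z) -` {0} \<inter> space (\<mu> \<Otimes>\<^sub>M \<mu>) \<in> sets (\<mu> \<Otimes>\<^sub>M \<mu>)"
    by (rule measurable_sets[of _ _ borel]) auto
  have "emeasure \<mu> {c} * emeasure \<mu> {c} = emeasure (\<mu> \<Otimes>\<^sub>M \<mu>) ({c} \<times> {c})"
    by (rule emeasure_pair_measure_Times[symmetric]) auto
  also have "\<dots> \<le> emeasure (\<mu> \<Otimes>\<^sub>M \<mu>) ((\<lambda>(y, z). y - z) -` {0} \<inter> space (\<mu> \<Otimes>\<^sub>M \<mu>))"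
    by (rule emeasure_mono[OF _ m]) (auto simp: space_pair_measure)
  finally have "emeasure \<mu> {c} = 0" using z by simp
  then show ?thesis by (intro AE_I[of _ _ "{c}"]) auto
qed

text \<open>The directions leading into \<open>G\<close> do not form a null set, whereas those
  leading to points of \<open>F\<close> do. \<open>F\<close> will be the set of points already
  occupied.\<close>

lemma avg_indicator_nonzero_obtain:
  assumes G: "G \<in> sets borel" and nz: "avg r (indicat_real G) x \<noteq> 0" and "finite F" "r > 0"
  obtains z where "z \<in> G" "norm (z - x) = r" "z \<notin> F"
proof -
  have "AE y in \<mu>. \<forall>c\<in>F. y \<noteq> (c - x) /\<^sub>R r"
    using \<open>finite F\<close> AE_not_eq by (subst AE_finite_all) auto
  moreover have "\<not> (AE y in \<mu>. indicat_real G (x + r *\<^sub>R y) = 0)"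
    using nz unfolding avg_def by (auto dest: integral_eq_zero_AE)
  ultimately have "\<exists>y. norm y = 1 \<and> (\<forall>c\<in>F. y \<noteq> (c - x) /\<^sub>R r) \<and> indicat_real G (x + r *\<^sub>R y) \<noteq> 0"
    using AE_norm
    by (smt (verit, ccfv_SIG) eventually_elim2)
  then obtain y where y: "norm y = 1" "\<forall>c\<in>F. y \<noteq> (c - x) /\<^sub>R r" "x + r *\<^sub>R y \<in> G"
    by (auto simp: indicator_eq_0_iff)
  show ?thesis
    by (rule that[of "x + r *\<^sub>R y"]) (use y \<open>r > 0\<close> in auto)
qed

text \<open>\<open>Q\<close> is meant to contain every point reached from \<open>A\<close> at the
  scales in use. Comparing its measure with that of \<open>A\<close> by a fixed \<open>L\<close>
  makes the later constants independent of the size of the box.\<close>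

definition host :: "real \<Rightarrow> 'a set \<Rightarrow> 'a set \<Rightarrow> bool" where
  "host L A Q \<longleftrightarrow> A \<in> sets borel \<and> emeasure lborel A < \<infinity> \<and> measure lborel A > 0 \<and>
     Q \<in> sets borel \<and> emeasure lborel Q < \<infinity> \<and> measure lborel Q \<le> L * measure lborel A"

text \<open>The energy bound says that, tested on \<open>A\<close>, the average over the arc of radius \<open>r\<close> is close
  in \<open>L\<^sup>2\<close> to the average over differences of two points of it.\<close>

definition good_scale :: "real \<Rightarrow> 'a set \<Rightarrow> 'a set \<Rightarrow> real \<Rightarrow> bool" where
  "good_scale \<kappa> A Q r \<longleftrightarrow> r > 0 \<and> (\<forall>x y. x \<in> A \<longrightarrow> norm y = r \<longrightarrow> x + y \<in> Q) \<and>
     (\<integral>x. (avg r (dif (-r) (indicat_real A)) x)\<^sup>2 \<partial>lborel) \<le> \<kappa>\<^sup>2 * measure lborel A"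

text \<open>Induction along the growth of the tree. Every vertex gets its own admissible set
  \<open>As v\<close>, nearly all of \<open>A\<close>, because removing a leaf shrinks the
  admissible set of its neighbour. The constants are fixed by the tree and \<open>L\<close>, before
  \<open>A\<close> is known.\<close>

lemma grown_tree_embedding:
  assumes "grown_tree V E" and L: "L > 0"
  shows "\<exists>\<tau>>0. \<exists>\<kappa>>0. \<forall>A Q len As. host L A Q \<longrightarrow> (\<forall>e\<in>E. good_scale \<kappa> A Q (len e)) \<longrightarrow>
    (\<forall>v\<in>V. As v \<in> sets borel \<and> As v \<subseteq> A \<and> measure lborel (A - As v) \<le> \<tau> * measure lborel A) \<longrightarrow>
    (\<exists>x. inj_on x V \<and> (\<forall>v\<in>V. x v \<in> As v) \<and> (\<forall>u v. {u, v} \<in> E \<longrightarrow> norm (x u - x v) = len {u, v}))"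
  using assms(1)
proof (induction rule: grown_tree.induct)
  case (single v)
  show ?case
  \<comment> \<open>At least half of \<open>A\<close> remains admissible, so \<open>As v\<close> is
    nonempty; the same value serves for both constants.\<close>
  proof (intro exI[of _ "1/2"] conjI allI impI)
    fix A Q and len :: "'b set \<Rightarrow> real" and As :: "'b \<Rightarrow> 'a set"
    assume h: "host L A Q"
      and As: "\<forall>v\<in>{v}. As v \<in> sets borel \<and> As v \<subseteq> A \<and> measure lborel (A - As v) \<le>
          1/2 * measure lborel A"
    have "As v \<noteq> {}" using As h by (auto simp: host_def)
    then obtain z where "z \<in> As v" by blast
    then show "\<exists>x. inj_on x {v} \<and> (\<forall>v\<in>{v}. x v \<in> As v) \<and> (\<forall>u v. {u, v} \<in> {} \<longrightarrow> norm (x u - x v) =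
        len {u, v})"
      by (intro exI[of _ "\<lambda>_. z"]) auto
  qed auto
next
  case (leaf V E u w)
  then obtain \<tau>0 \<kappa>0 where pos: "\<tau>0 > 0" "\<kappa>0 > 0"
    and IH: "\<And>A Q len As. host L A Q \<Longrightarrow> (\<forall>e\<in>E. good_scale \<kappa>0 A Q (len e)) \<Longrightarrow>
    (\<forall>v\<in>V. As v \<in> sets borel \<and> As v \<subseteq> A \<and> measure lborel (A - As v) \<le> \<tau>0 * measure lborel A) \<Longrightarrow>
    (\<exists>x. inj_on x V \<and> (\<forall>v\<in>V. x v \<in> As v) \<and> (\<forall>u v. {u, v} \<in> E \<longrightarrow> norm (x u - x v) = len {u, v}))"
    by blast
  \<comment> \<open>The quotients by \<open>8 * L\<close> make
    \<open>L * (\<tau> + \<kappa>)\<close> at most \<open>(\<tau>0 / 2)\<^sup>2\<close>, so the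
    points removed at \<open>u\<close> cost at most half of \<open>\<tau>0\<close>; the other half
    covers what \<open>As u\<close> misses already.\<close>
  define \<tau> where "\<tau> = min (\<tau>0 / 2) (\<tau>0\<^sup>2 / (8 * L))"
  define \<kappa> where "\<kappa> = min \<kappa>0 (\<tau>0\<^sup>2 / (8 * L))"
  have tp: "\<tau> > 0" "\<kappa> > 0" "\<kappa> \<le> \<kappa>0" "\<tau> \<le> \<tau>0 / 2" using pos L by (auto simp: \<tau>_def \<kappa>_def)
  have "L * (\<tau> + \<kappa>) \<le> L * (\<tau>0\<^sup>2 / (8 * L) + \<tau>0\<^sup>2 / (8 * L))"
    using L by (intro mult_left_mono add_mono) (auto simp: \<tau>_def \<kappa>_def)
  also have "\<dots> = (\<tau>0 / 2)\<^sup>2" using L by (simp add: power2_eq_square field_simps)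
  finally have Lt: "L * (\<tau> + \<kappa>) \<le> (\<tau>0 / 2)\<^sup>2" .
  show ?case
  proof (rule exI[of _ \<tau>], rule conjI[OF tp(1)], rule exI[of _ \<kappa>], rule conjI[OF tp(2)], intro allI
      impI)
    fix A Q and len :: "'b set \<Rightarrow> real" and As :: "'b \<Rightarrow> 'a set"
    assume h: "host L A Q" and gs: "\<forall>e\<in>insert {u, w} E. good_scale \<kappa> A Q (len e)"
      and As: "\<forall>v\<in>insert w V. As v \<in> sets borel \<and> As v \<subseteq> A \<and> measure lborel (A - As v) \<le>
          \<tau> * measure lborel A"
    define r where "r = len {u, w}"
    have gr: "good_scale \<kappa> A Q r" using gs by (simp add: r_def)
    then have r: "r > 0" by (simp add: good_scale_def)
    define G where "G = As w"
    have G: "G \<in> sets borel" "G \<subseteq> A" "measure lborel (A - G) \<le> \<tau> * measure lborel A"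
      using As by (auto simp: G_def)
    have A: "A \<in> sets borel" "emeasure lborel A < \<infinity>" "measure lborel A > 0" using h
      by (auto simp: host_def)
    have fmA: "A \<in> fmeasurable lborel" using A by (simp add: fmeasurable_def)
    \<comment> \<open>Forbidden positions for \<open>u\<close>: from these points almost no
      direction of the arc leads to a position allowed for \<open>w\<close>.\<close>
    define B where "B = {x \<in> A. avg r (indicat_real G) x = 0}"
    have B: "B \<in> sets borel" "B \<subseteq> A"
    proof -
      have [measurable]: "avg r (indicat_real G) \<in> borel_measurable borel" "A \<in> sets borel"
        using bdd_measurable[OF avg_bdd[OF bdd_indicator[OF G(1)]]] A by auto
      show "B \<in> sets borel" unfolding B_def by measurable
    qed (auto simp: B_def)
    have "(measure lborel B)\<^sup>2 \<le> L * (\<tau> + \<kappa>) * (measure lborel A)\<^sup>2"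
      by (rule bad_set_small[OF A(1,2) B G(1,2), of Q r])
         (use h gr G tp L in \<open>auto simp: host_def good_scale_def B_def\<close>)
    also have "\<dots> \<le> (\<tau>0 / 2)\<^sup>2 * (measure lborel A)\<^sup>2" using Lt by (intro mult_right_mono) auto
    finally have "(measure lborel B)\<^sup>2 \<le> (\<tau>0 / 2 * measure lborel A)\<^sup>2"
      by (simp only: power_mult_distrib)
    then have mB: "measure lborel B \<le> \<tau>0 / 2 * measure lborel A"
      by (rule power2_le_imp_le) (use pos in auto)
    define As' where "As' = As(u := As u - B)"
    have Asu: "As u \<in> sets borel" "As u \<subseteq> A" "measure lborel (A - As u) \<le> \<tau> * measure lborel A"
      using As leaf.hyps by auto
    have fmB: "B \<in> fmeasurable lborel" and fmD: "A - As u \<in> fmeasurable lborel"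
      using B Asu A by (auto intro: fmeasurableI2[OF fmA])
    have "measure lborel (A - (As u - B)) \<le> measure lborel ((A - As u) \<union> B)"
      using fmB fmD A(1) B Asu by (intro measure_mono_fmeasurable) auto
    also have "\<dots> \<le> measure lborel (A - As u) + measure lborel B"
      using fmB fmD by (intro measure_Un_le) auto
    also have "\<dots> \<le> \<tau>0 / 2 * measure lborel A + \<tau>0 / 2 * measure lborel A"
      using order_trans[OF Asu(3) mult_right_mono[OF tp(4)]] mB A(3) by simp
    finally have mu: "measure lborel (A - (As u - B)) \<le> \<tau>0 * measure lborel A" by simp
    have mv: "measure lborel (A - As v) \<le> \<tau>0 * measure lborel A" if "v \<in> V" for v
    proof -
      have "measure lborel (A - As v) \<le> \<tau> * measure lborel A" using As that by auto
      also have "\<dots> \<le> \<tau>0 * measure lborel A" using tp pos A(3) by (intro mult_right_mono) auto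
      finally show ?thesis .
    qed
    have gs0: "\<forall>e\<in>E. good_scale \<kappa>0 A Q (len e)"
    proof
      fix e assume "e \<in> E"
      then have g: "good_scale \<kappa> A Q (len e)" using gs by auto
      have "\<kappa>\<^sup>2 * measure lborel A \<le> \<kappa>0\<^sup>2 * measure lborel A"
        using tp by (intro mult_right_mono power_mono) auto
      then show "good_scale \<kappa>0 A Q (len e)" using g by (auto simp: good_scale_def)
    qed
    have As': "\<forall>v\<in>V. As' v \<in> sets borel \<and> As' v \<subseteq> A \<and> measure lborel (A - As' v) \<le>
        \<tau>0 * measure lborel A"
      using As Asu B mu mv by (auto simp: As'_def)
    obtain x where x: "inj_on x V" "\<forall>v\<in>V. x v \<in> As' v" "\<forall>u v. {u, v} \<in> E \<longrightarrow> norm (x u - x v) =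
        len {u, v}"
      using IH[OF h gs0 As'] by blast
    have "x u \<in> As u - B" using bspec[OF x(2) leaf.hyps(2)] by (simp add: As'_def)
    then have "x u \<in> A - B" using Asu(2) by auto
    then have nz: "avg r (indicat_real G) (x u) \<noteq> 0" by (auto simp: B_def)
    have "finite (x ` V)" using grown_tree_finite[OF leaf.hyps(1)] by simp
    then obtain z where z: "z \<in> G" "norm (z - x u) = r" "z \<notin> x ` V"
      using avg_indicator_nonzero_obtain[OF G(1) nz _ r] by blast
    let ?x = "x(w := z)"
    have "inj_on ?x (insert w V)"
      using x(1) z(3) leaf.hyps(3) by (auto simp: inj_on_def)
    moreover have "?x v \<in> As v" if "v \<in> insert w V" for v
      using that x(2) z(1) leaf.hyps(3) by (auto simp: As'_def G_def split: if_splits)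
    moreover have "norm (?x a - ?x b) = len {a, b}" if e: "{a, b} \<in> insert {u, w} E" for a b
    proof (cases "{a, b} = {u, w}")
      case True
      have "u \<noteq> w" using leaf.hyps by auto
      then have "norm (?x a - ?x b) = r" using True z(2)
        by (auto simp: doubleton_eq_iff norm_minus_commute)
      then show ?thesis using True by (simp add: r_def)
    next
      case False
      then have "{a, b} \<in> E" using e by auto
      moreover from this have "a \<noteq> w" "b \<noteq> w" using grown_tree_edges[OF leaf.hyps(1)] leaf.hyps(3)
        by blast+
      ultimately show ?thesis using x(3) by simp
    qed
    ultimately show "\<exists>x. inj_on x (insert w V) \<and> (\<forall>v\<in>insert w V. x v \<in> As v) \<and>
       (\<forall>a b. {a, b} \<in> insert {u, w} E \<longrightarrow> norm (x a - x b) = len {a, b})"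
      by blast
  qed
qed

end

section \<open>Sets of positive upper Banach density\<close>

text \<open>Any \<open>\<delta>\<close> strictly between zero and the upper density works: if all
  boxes from some size on had smaller density, the limit superior would be at most
  \<open>\<delta>\<close>.\<close>

lemma upper_Banach_density_pos_imp_dense_boxes:
  fixes A :: "(real ^ 'd) set"
  assumes "upper_Banach_density A > 0"
  obtains \<delta> :: real where "\<delta> > 0" "\<And>R0. \<exists>R\<ge>R0. \<exists>x. \<delta> * R ^ CARD('d) \<le>
    measure lebesgue (A \<inter> (\<lambda>y. x + y) ` cbox 0 (\<chi> i. R))"
proof -
  obtain \<delta> :: real where d: "0 < ereal \<delta>" "ereal \<delta> < upper_Banach_density A"
    using ereal_dense2[OF assms] by blast
  have "\<exists>R\<ge>R0. \<exists>x. \<delta> * R ^ CARD('d) \<le> measure lebesgue (A \<inter> (\<lambda>y. x + y) ` cbox 0 (\<chi> i. R))" for R0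
  proof (rule ccontr)
    assume neg: "\<not> ?thesis"
    have "eventually (\<lambda>R::real. R \<ge> max R0 1) at_top" by (rule eventually_ge_at_top)
    then have "eventually (\<lambda>R. (SUP x::real ^ 'd.
       ereal (measure lebesgue (A \<inter> (\<lambda>y. x + y) ` cbox 0 (\<chi> i. R)) / R ^ CARD('d))) \<le> ereal \<delta>)
           at_top"
    proof eventually_elim
      case (elim R)
      show ?case
      proof (rule SUP_least)
        fix x :: "real ^ 'd"
        have "measure lebesgue (A \<inter> (\<lambda>y. x + y) ` cbox 0 (\<chi> i. R)) < \<delta> * R ^ CARD('d)"
          using neg max.boundedE[OF elim] by (meson not_le)
        moreover have "R ^ CARD('d) > 0" using elim by simp
        ultimately show "ereal (measure lebesgue (A \<inter> (\<lambda>y. x + y) ` cbox 0 (\<chi> i. R)) / R ^ CARD('d))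
            \<le> ereal \<delta>"
          by (simp add: divide_le_eq)
      qed
    qed
    then have "upper_Banach_density A \<le> ereal \<delta>"
      unfolding upper_Banach_density_def by (rule Limsup_bounded)
    then show False using d(2) by simp
  qed
  then show ?thesis using that[of \<delta>] d(1) by simp
qed

text \<open>Consecutive terms grow by a factor \<open>c\<close> whose powers
  \<open>c powr a k\<close> are all at least \<open>1 / \<eta>\<close>, so the radii of all edges
  become lacunary at once.\<close>

lemma powr_lacunary_sequence:
  fixes P :: "real \<Rightarrow> bool" and a :: "nat \<Rightarrow> real"
  assumes "\<eta> > 0" and a: "\<And>k. k \<in> {1..n} \<Longrightarrow> a k > 0"
    and unbounded: "\<And>l. l > 0 \<Longrightarrow> \<exists>lam\<ge>l. P lam"
  obtains s :: "nat \<Rightarrow> real" where "\<And>j. P (s j)" "\<And>j. s j \<ge> 1"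
    "\<And>i j k. i < j \<Longrightarrow> k \<in> {1..n} \<Longrightarrow> s i powr a k \<le> \<eta> * s j powr a k"
proof -
  \<comment> \<open>The sum dominates the factor required by each single exponent, and the leading
    one keeps the sequence nondecreasing.\<close>
  define c where "c = 1 + (\<Sum>k\<in>{1..n}. (1 / \<eta>) powr (1 / a k))"
  have c1: "c \<ge> 1" by (auto simp: c_def intro: sum_nonneg)
  have ck: "(1 / \<eta>) powr (1 / a k) \<le> c" if "k \<in> {1..n}" for k
  proof -
    have "(1 / \<eta>) powr (1 / a k) \<le> (\<Sum>k\<in>{1..n}. (1 / \<eta>) powr (1 / a k))"
      by (rule member_le_sum) (use that in auto)
    then show ?thesis by (simp add: c_def)
  qed
  have "\<exists>s. \<forall>j. (s j \<ge> 1 \<and> P (s j)) \<and> c * s j \<le> s (Suc j)"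
  proof (rule dependent_nat_choice)
    show "\<exists>x\<ge>1. P x" using unbounded[of 1] by simp
    fix x :: real assume x: "1 \<le> x \<and> P x"
    then have cx: "1 * 1 \<le> c * x" using c1 by (intro mult_mono) auto
    then obtain y where "y \<ge> c * x" "P y" using unbounded[of "c * x"] by auto
    then show "\<exists>y. (1 \<le> y \<and> P y) \<and> c * x \<le> y" using cx by (intro exI[of _ y]) auto
  qed
  then obtain s where lam: "\<And>j. s j \<ge> 1" "\<And>j. P (s j)" "\<And>j. c * s j \<le> s (Suc j)" by blast
  have grow: "c * s i \<le> s j" if "i < j" for i j
    using that
  proof (induction j)
    case (Suc j)
    show ?case
    proof (cases "i = j")
      case False
      then have "c * s i \<le> s j" using Suc by simp
      also have "s j \<le> c * s j" using c1 lam(1)[of j] by simp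
      also have "\<dots> \<le> s (Suc j)" by (rule lam(3))
      finally show ?thesis .
    qed (use lam(3) in simp)
  qed simp
  have "s i powr a k \<le> \<eta> * s j powr a k" if "i < j" "k \<in> {1..n}" for i j k
  proof -
    have ak: "a k > 0" using a that by auto
    have "1 / \<eta> = ((1 / \<eta>) powr (1 / a k)) powr a k" using ak \<open>\<eta> > 0\<close> by (simp add: powr_powr)
    also have "\<dots> \<le> c powr a k" using ck[OF that(2)] ak by (intro powr_mono2) auto
    finally have "1 / \<eta> * s i powr a k \<le> c powr a k * s i powr a k" by (intro mult_right_mono) auto
    also have "\<dots> = (c * s i) powr a k" using c1 lam(1)[of i] by (simp add: powr_mult)
    also have "\<dots> \<le> s j powr a k" using grow[OF that(1)] ak c1 lam(1)[of i]
      by (intro powr_mono2) auto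
    finally show ?thesis using \<open>\<eta> > 0\<close> by (simp add: field_simps)
  qed
  then show ?thesis using that lam by blast
qed

lemma sphere_around_box_point:
  fixes x z y :: "real ^ 'd"
  assumes "x \<in> cbox z (z + (\<chi> i. R))" "norm y \<le> R"
  shows "x + y \<in> cbox (z - (\<chi> i. R)) (z + (\<chi> i. 2 * R))"
  unfolding mem_box_cart
proof
  fix i
  have "\<bar>y $ i\<bar> \<le> R" using component_le_norm_cart[of y i] assms(2) by linarith
  moreover have "z $ i \<le> x $ i" "x $ i \<le> z $ i + R" using assms(1) by (auto simp: mem_box_cart)
  ultimately show "(z - (\<chi> i. R)) $ i \<le> (x + y) $ i \<and> (x + y) $ i \<le> (z + (\<chi> i. 2 * R)) $ i"
    by (auto simp: abs_le_iff)
qed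

text \<open>From arbitrarily large failing parameters a lacunary sequence is drawn, and only then a
  dense box at least as large as the finitely many radii in play. Each edge spoils at most
  \<open>M\<close> parameters, so one of them is good for all edges, and its embedding contradicts
  failure.\<close>

lemma distance_tree_in_borel_set:
  fixes n :: nat and a b :: "nat \<Rightarrow> real" and V :: "'v set" and E :: "'v set set"
    and A :: "(real ^ 2) set"
  assumes a: "\<And>k. k \<in> {1..n} \<Longrightarrow> a k > 0" and b: "\<And>k. k \<in> {1..n} \<Longrightarrow> b k > 0"
    and tree: "grown_tree V E" and bij: "bij_betw edge {1..n} E"
    and A: "A \<in> sets borel" and "\<delta> > 0"
    and dense: "\<And>R0. \<exists>R\<ge>R0. \<exists>z. \<delta> * R\<^sup>2 \<le> measure lborel (A \<inter> cbox z (z + (\<chi> i. R)))"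
  shows "\<exists>lam0 > 0. \<forall>lam \<ge> lam0. \<exists>x :: 'v \<Rightarrow> real ^ 2.
           x ` V \<subseteq> A \<and> inj_on x V \<and>
           (\<forall>k \<in> {1..n}. \<forall>u v. edge k = {u, v} \<longrightarrow> norm (x u - x v) = lam powr a k * b k)"
proof (rule ccontr)
  assume neg: "\<not> ?thesis"
  define none where "none lam \<longleftrightarrow> (\<nexists>x :: 'v \<Rightarrow> real ^ 2. x ` V \<subseteq> A \<and> inj_on x V \<and>
           (\<forall>k \<in> {1..n}. \<forall>u v. edge k = {u, v} \<longrightarrow> norm (x u - x v) = lam powr a k * b k))" for lam
  have unbounded: "\<exists>lam\<ge>l. none lam" if "l > 0" for l
    using neg that unfolding none_def by blast
  \<comment> \<open>\<open>Q\<close> below has side \<open>3 * R\<close>, hence area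
    \<open>9 * R\<^sup>2\<close>, against at least \<open>\<delta> * R\<^sup>2\<close> for
    \<open>A0\<close>.\<close>
  define L where "L = 9 / \<delta>"
  have "L > 0" using \<open>\<delta> > 0\<close> by (simp add: L_def)
  obtain \<tau> \<kappa> where pos: "\<tau> > 0" "\<kappa> > 0" and emb:
    "\<And>A Q len As. arc.host L A Q \<Longrightarrow> (\<forall>e\<in>E. arc.good_scale \<kappa> A Q (len e)) \<Longrightarrow>
    (\<forall>v\<in>V. As v \<in> sets borel \<and> As v \<subseteq> A \<and> measure lborel (A - As v) \<le> \<tau> * measure lborel A) \<Longrightarrow>
    (\<exists>x. inj_on x V \<and> (\<forall>v\<in>V. x v \<in> As v) \<and> (\<forall>u v. {u, v} \<in> E \<longrightarrow> norm (x u - x v) = len {u, v}))"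
    using arc.grown_tree_embedding[OF tree \<open>L > 0\<close>] by blast
  have "\<kappa>\<^sup>2 > 0" using pos by simp
  then obtain \<eta> M where "\<eta> > 0" and few:
    "\<And>(I :: nat set) r f m. finite I \<Longrightarrow> arc.adm 1 m f \<Longrightarrow> m > 0 \<Longrightarrow> (\<And>i. i \<in> I \<Longrightarrow> r i > 0) \<Longrightarrow>
       (\<And>i j. i \<in> I \<Longrightarrow> j \<in> I \<Longrightarrow> i < j \<Longrightarrow> r i \<le> \<eta> * r j) \<Longrightarrow>
       (\<And>i. i \<in> I \<Longrightarrow> \<kappa>\<^sup>2 * m \<le> (\<integral>x. (arc.avg (r i) (arc.dif (- r i) f) x)\<^sup>2 \<partial>lborel)) \<Longrightarrow> card I \<le> M"
    using arc.bounded_bad_scales by metis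
  obtain s :: "nat \<Rightarrow> real" where lam: "\<And>j. none (s j)" "\<And>j. s j \<ge> 1"
    "\<And>i j k. i < j \<Longrightarrow> k \<in> {1..n} \<Longrightarrow> s i powr a k \<le> \<eta> * s j powr a k"
    using powr_lacunary_sequence[of \<eta> n a none] \<open>\<eta> > 0\<close> a unbounded by metis
  define r where "r k j = s j powr a k * b k" for k j
  have rpos: "r k j > 0" if "k \<in> {1..n}" for k j
    using b[OF that] lam(2)[of j] by (auto simp: r_def intro!: mult_pos_pos)
  have rnn: "r k j \<ge> 0" if "k \<in> {1..n}" for k j
    using rpos[OF that] by (rule less_imp_le)
  have rlac: "r k i \<le> \<eta> * r k j" if "k \<in> {1..n}" "i < j" for k i j
    using mult_right_mono[OF lam(3)[OF that(2,1)], of "b k"] b[OF that(1)] by (simp add: r_def)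
  \<comment> \<open>One parameter more than the \<open>n\<close> edges can spoil together.\<close>
  define J where "J = Suc (n * M)"
  \<comment> \<open>A sum of positive terms dominates each radius, so spheres of these radii around
    points of the box stay in \<open>Q\<close>.\<close>
  define R0 where "R0 = 1 + (\<Sum>j<J. \<Sum>k\<in>{1..n}. r k j)"
  have rR0: "r k j \<le> R0" if "k \<in> {1..n}" "j < J" for k j
  proof -
    have "r k j \<le> (\<Sum>k\<in>{1..n}. r k j)"
      by (rule member_le_sum) (use that rnn in auto)
    also have "\<dots> \<le> (\<Sum>j<J. \<Sum>k\<in>{1..n}. r k j)"
      by (rule member_le_sum[of j "{..<J}" "\<lambda>j. \<Sum>k\<in>{1..n}. r k j"])
         (use that rnn in \<open>auto intro!: sum_nonneg\<close>)
    finally show ?thesis by (simp add: R0_def)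
  qed
  have "R0 \<ge> 1" unfolding R0_def using rnn by (auto intro!: sum_nonneg)
  obtain R z where R: "R \<ge> R0" "\<delta> * R\<^sup>2 \<le> measure lborel (A \<inter> cbox z (z + (\<chi> i. R)))"
    using dense by blast
  define A0 where "A0 = A \<inter> cbox z (z + (\<chi> i. R))"
  define Q where "Q = cbox (z - (\<chi> i. R)) (z + (\<chi> i. 2 * R))"
  have "R \<ge> 1" using R(1) \<open>R0 \<ge> 1\<close> by simp
  have mQ: "measure lborel Q = 9 * R\<^sup>2"
    unfolding Q_def using \<open>R \<ge> 1\<close>
    by (subst content_cbox_cart) (auto simp: interval_ne_empty_cart UNIV_2 power2_eq_square)
  have mA0: "\<delta> * R\<^sup>2 \<le> measure lborel A0" using R(2) by (simp add: A0_def)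
  have A0: "A0 \<in> sets borel" using A by (auto simp: A0_def)
  have fin: "emeasure lborel A0 < \<infinity>"
    unfolding A0_def by (intro emeasure_bounded_finite bounded_Int) auto
  have "0 < \<delta> * R\<^sup>2" using \<open>\<delta> > 0\<close> \<open>R \<ge> 1\<close> by simp
  then have posA0: "measure lborel A0 > 0" using mA0 by linarith
  have "L * (\<delta> * R\<^sup>2) \<le> L * measure lborel A0"
    using mA0 \<open>L > 0\<close> by (intro mult_left_mono) auto
  then have "measure lborel Q \<le> L * measure lborel A0" using \<open>\<delta> > 0\<close> by (simp add: L_def mQ)
  moreover have "emeasure lborel Q < \<infinity>" unfolding Q_def by (intro emeasure_bounded_finite) auto
  ultimately have host: "arc.host L A0 Q"
    using A0 fin posA0 by (auto simp: arc.host_def Q_def)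
  have sphere: "x + y \<in> Q" if "x \<in> A0" "norm y = r k j" "k \<in> {1..n}" "j < J" for x y k j
    unfolding Q_def by (rule sphere_around_box_point) (use that rR0[OF that(3,4)] R(1) in \<open>auto
        simp: A0_def\<close>)
  define bad where "bad k = {j. j < J \<and> \<not> arc.good_scale \<kappa> A0 Q (r k j)}" for k
  have "card (bad k) \<le> M" if k: "k \<in> {1..n}" for k
  proof (rule few[OF _ arc.adm_indicator[OF A0 fin] posA0])
    show "finite (bad k)" by (simp add: bad_def)
    \<comment> \<open>The radius is positive and the spheres stay in \<open>Q\<close>, so a bad
      scale can only violate the energy bound.\<close>
    show "\<kappa>\<^sup>2 * measure lborel A0 \<le>
        (\<integral>x. (arc.avg (r k j) (arc.dif (- r k j) (indicat_real A0)) x)\<^sup>2 \<partial>lborel)" if "j \<in> bad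
            k" for j
      using that rpos[OF k] sphere[OF _ _ k] by (auto simp: bad_def arc.good_scale_def)
  qed (use rpos[OF k] rlac[OF k] in auto)
  then have "card (\<Union>k\<in>{1..n}. bad k) \<le> (\<Sum>k\<in>{1..n}. M)"
    by (intro order_trans[OF card_UN_le sum_mono]) auto
  also have "\<dots> < card {..<J}" by (simp add: J_def)
  finally have "\<not> {..<J} \<subseteq> (\<Union>k\<in>{1..n}. bad k)"
    using card_mono[of "\<Union>k\<in>{1..n}. bad k" "{..<J}"] by (auto simp: bad_def)
  then obtain j where j: "j < J" "\<And>k. k \<in> {1..n} \<Longrightarrow> arc.good_scale \<kappa> A0 Q (r k j)"
    unfolding bad_def by blast
  define len where "len e = r (inv_into {1..n} edge e) j" for e
  have len: "len (edge k) = r k j" if "k \<in> {1..n}" for k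
    using bij_betw_inv_into_left[OF bij that] by (simp add: len_def)
  have E: "E = edge ` {1..n}" using bij by (simp add: bij_betw_def)
  \<comment> \<open>Nothing is discarded at the start: each vertex may lie anywhere in
    \<open>A0\<close>.\<close>
  obtain x :: "'v \<Rightarrow> real ^ 2" where x: "inj_on x V" "\<forall>v\<in>V. x v \<in> A0"
    "\<forall>u v. {u, v} \<in> E \<longrightarrow> norm (x u - x v) = len {u, v}"
    using emb[OF host, of len "\<lambda>_. A0"] j(2) len A0 pos posA0 unfolding E by auto
  have "norm (x u - x v) = s j powr a k * b k" if "k \<in> {1..n}" "edge k = {u, v}" for k u v
  proof -
    have "{u, v} \<in> E" unfolding E using that by (metis imageI)
    then have "norm (x u - x v) = len {u, v}" using x(3) by blast
    then show ?thesis using len[OF that(1)] that(2) by (simp add: r_def)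
  qed
  moreover have "x ` V \<subseteq> A" using x(2) by (auto simp: A0_def)
  ultimately show False using lam(1)[of j] x(1) unfolding none_def by blast
qed

theorem theorem3:
  fixes n :: nat
    and a b :: "nat \<Rightarrow> real"
    and V :: "'v set"
    and E :: "'v set set"
    and edge :: "nat \<Rightarrow> 'v set"
    and A :: "(real ^ 2) set"
  assumes "n \<ge> 1"
    and "\<And>k. k \<in> {1..n} \<Longrightarrow> a k > 0"
    and "\<And>k. k \<in> {1..n} \<Longrightarrow> b k > 0"
    and "finite_tree V E"
    and "bij_betw edge {1..n} E"
    and "A \<in> sets lebesgue"
    and "upper_Banach_density A > 0"
  shows "\<exists>lam0 > 0. \<forall>lam \<ge> lam0. \<exists>x :: 'v \<Rightarrow> real ^ 2.
           x ` V \<subseteq> A \<and> inj_on x V \<and>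
           (\<forall>k \<in> {1..n}. \<forall>u v. edge k = {u, v} \<longrightarrow> norm (x u - x v) = lam powr a k * b k)"
proof -
  \<comment> \<open>The averages are set up for Borel functions, so \<open>A\<close> is replaced by
    a Borel subset of full measure, which leaves the measure in every box unchanged.\<close>
  obtain C T where CT: "fsigma C" "T \<in> null_sets lebesgue" "C \<union> T = A" "disjnt C T"
    using lebesgue_set_almost_fsigma[OF assms(6)] by blast
  have C: "C \<in> sets borel" using CT(1) by (auto elim!: fsigma.cases)
  obtain \<delta> :: real where d: "\<delta> > 0" "\<And>R0. \<exists>R\<ge>R0. \<exists>x. \<delta> * R ^ CARD(2) \<le>
    measure lebesgue (A \<inter> (\<lambda>y. x + y) ` cbox 0 (\<chi> i. R))"
    using upper_Banach_density_pos_imp_dense_boxes[OF assms(7)] by metis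
  have eq: "measure lebesgue (A \<inter> (\<lambda>y. z + y) ` cbox 0 (\<chi> i. R)) = measure lborel (C \<inter> cbox z (z +
      (\<chi> i. R)))" for z R
  proof -
    let ?S = "cbox z (z + (\<chi> i. R))"
    have "(\<lambda>y. z + y) ` cbox 0 (\<chi> i. R) = ?S"
      using cbox_translation[of z 0 "\<chi> i. R"] by simp
    then have "A \<inter> (\<lambda>y. z + y) ` cbox 0 (\<chi> i. R) = (C \<inter> ?S) \<union> (T \<inter> ?S)" using CT(3) by auto
    moreover have "T \<inter> ?S \<in> null_sets lebesgue" using CT(2) by (intro null_set_Int2) auto
    ultimately show ?thesis
      using C by (simp add: measure_Un_null_set)
  qed
  have "\<exists>lam0 > 0. \<forall>lam \<ge> lam0. \<exists>x :: 'v \<Rightarrow> real ^ 2.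
           x ` V \<subseteq> C \<and> inj_on x V \<and>
           (\<forall>k \<in> {1..n}. \<forall>u v. edge k = {u, v} \<longrightarrow> norm (x u - x v) = lam powr a k * b k)"
    by (rule distance_tree_in_borel_set[OF assms(2,3) finite_tree_imp_grown_tree[OF assms(4)]
        assms(5) C d(1)])
       (use d(2) in \<open>simp_all add: eq\<close>)
  moreover have "C \<subseteq> A" using CT(3) by auto
  ultimately show ?thesis by (meson order_trans)
qed

end
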